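(* ($N$-dark/anti-dark soliton solution.) Let $\sigma=\pm1$, let $a_1,a_2,b_1,b_2$ be nonzero real numbers with $b_1\ne b_2$, let $z_1,\dots,z_N$ be distinct nonzero real numbers and for each $i$ let $\kappa_i\in\mathbb C\setminus\mathbb R$ satisfy $$(z_i^{-1}\kappa_i-2)(\kappa_i+b_1)(\kappa_i+b_2)+a_1^2b_1^2(\kappa_i+b_2)+\sigma a_2^2b_2^2(\kappa_i+b_1)=0.$$ Let $\vartheta_i=\mathrm i(\kappa_i-z_i)\Big(x+\frac{1}{2b_1b_2z_i}(\kappa_i-z_i+b_1+b_2)t\Big)$, $\varsigma_i\in\{1,-1\}$, and $$M=\left(\frac{1}{\kappa_j-\kappa_i^*}\Big[\kappa_i^*\mathrm e^{\vartheta_j+\vartheta_i^*}+\delta_{i,j}\varsigma_i|\kappa_i|\Big]\right)_{1\le i,j\le N},\quad H_s=\left(\frac{1}{\kappa_j-\kappa_i^*}\Big[\frac{\kappa_i^*+b_s}{\kappa_j+b_s}\kappa_j\mathrm e^{\vartheta_j+\vartheta_i^*}+\delta_{i,j}\varsigma_i|\kappa_i|\Big]\right)_{1\le i,j\le N}.$$ Then, wherever $\det M\neq0$, the functions $$u_s[N]=a_s\frac{\det H_s}{\det M}\,\mathrm e^{\mathrm i\omega_s},\qquad s=1,2,$$ solve the coupled Fokas–Lenells equation $$u_{1,xt}+u_1+\mathrm i(|u_1|^2+\tfrac12\sigma|u_2|^2)u_{1,x}+\tfrac{\mathrm i}{2}\sigma u_1u_2^*u_{2,x}=0,\qquad u_{2,xt}+u_2+\mathrm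 i(\sigma|u_2|^2+\tfrac12|u_1|^2)u_{2,x}+\tfrac{\mathrm i}{2}u_2u_1^*u_{1,x}=0.$$
   Context: $\delta_{i,j}$ is the Kronecker delta, $^*$ is complex conjugation, and the background phases are $\omega_1=b_1x-\frac12\big(2a_1^2+\sigma a_2^2-\frac{2}{b_1}+\sigma a_2^2\frac{b_2}{b_1}\big)t$, $\omega_2=b_2x-\frac12\big(2\sigma a_2^2+a_1^2-\frac{2}{b_2}+a_1^2\frac{b_1}{b_2}\big)t$. *)

theory Defs
  imports "HOL-Analysis.Analysis"
begin

definition partial_x :: "(real \<Rightarrow> real \<Rightarrow> complex) \<Rightarrow> real \<Rightarrow> real \<Rightarrow> complex" where
  "partial_x u x t = vector_derivative (\<lambda>y. u y t) (at x)"

definition partial_t :: "(real \<Rightarrow> real \<Rightarrow> complex) \<Rightarrow> real \<Rightarrow> real \<Rightarrow> complex" where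
  "partial_t u x t = vector_derivative (\<lambda>\<tau>. u x \<tau>) (at t)"

text \<open>
  Classical solutions of the coupled Fokas--Lenells equation on an open set of points \<open>(x, t)\<close>.
  Since \<^const>\<open>vector_derivative\<close> is a choice operator, the existence of \<open>u\<^sub>x\<close> and
  \<open>u\<^sub>x\<^sub>t\<close> is required explicitly; openness makes both meaningful at every point of the set.
\<close>

definition has_xt_derivs_on :: "(real \<times> real) set \<Rightarrow> (real \<Rightarrow> real \<Rightarrow> complex) \<Rightarrow> bool" where
  "has_xt_derivs_on D u \<longleftrightarrow>
     (\<forall>(x, t) \<in> D. (\<lambda>y. u y t) differentiable (at x) \<and>
                   (\<lambda>\<tau>. partial_x u x \<tau>) differentiable (at t))"

definition coupled_FL_solution_on ::
  "real \<Rightarrow> (real \<times> real) set \<Rightarrow> (real \<Rightarrow> real \<Rightarrow> complex) \<Rightarrow> (real \<Rightarrow> real \<Rightarrow> complex) \<Rightarrow> bool"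
where
  "coupled_FL_solution_on \<sigma> D u1 u2 \<longleftrightarrow>
     open D \<and> has_xt_derivs_on D u1 \<and> has_xt_derivs_on D u2 \<and>
     (\<forall>(x, t) \<in> D.
        partial_t (partial_x u1) x t + u1 x t
          + \<i> * of_real ((cmod (u1 x t))\<^sup>2 + 1/2 * \<sigma> * (cmod (u2 x t))\<^sup>2) * partial_x u1 x t
          + \<i> / 2 * of_real \<sigma> * u1 x t * cnj (u2 x t) * partial_x u2 x t = 0 \<and>
        partial_t (partial_x u2) x t + u2 x t
          + \<i> * of_real (\<sigma> * (cmod (u2 x t))\<^sup>2 + 1/2 * (cmod (u1 x t))\<^sup>2) * partial_x u2 x t
          + \<i> / 2 * u2 x t * cnj (u1 x t) * partial_x u1 x t = 0)"

definition omega1 :: "real \<Rightarrow> real \<Rightarrow> real \<Rightarrow> real \<Rightarrow> real \<Rightarrow> real \<Rightarrow> real \<Rightarrow> real" where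
  "omega1 \<sigma> a1 a2 b1 b2 x t =
     b1 * x - 1/2 * (2 * a1\<^sup>2 + \<sigma> * a2\<^sup>2 - 2 / b1 + \<sigma> * a2\<^sup>2 * (b2 / b1)) * t"

definition omega2 :: "real \<Rightarrow> real \<Rightarrow> real \<Rightarrow> real \<Rightarrow> real \<Rightarrow> real \<Rightarrow> real \<Rightarrow> real" where
  "omega2 \<sigma> a1 a2 b1 b2 x t =
     b2 * x - 1/2 * (2 * \<sigma> * a2\<^sup>2 + a1\<^sup>2 - 2 / b2 + a1\<^sup>2 * (b1 / b2)) * t"

definition vartheta :: "real \<Rightarrow> real \<Rightarrow> real \<Rightarrow> complex \<Rightarrow> real \<Rightarrow> real \<Rightarrow> complex" where
  "vartheta b1 b2 z \<kappa> x t =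
     \<i> * (\<kappa> - of_real z) *
     (of_real x + 1 / of_real (2 * b1 * b2 * z) * (\<kappa> - of_real z + of_real b1 + of_real b2) * of_real t)"

text \<open>
  The \<open>N\<close> solitons are indexed by a finite type \<^typ>\<open>'n\<close>, so \<open>N\<close> is \<open>CARD('n)\<close>.
\<close>

definition M_matrix ::
  "real \<Rightarrow> real \<Rightarrow> ('n::finite \<Rightarrow> real) \<Rightarrow> ('n \<Rightarrow> complex) \<Rightarrow> ('n \<Rightarrow> real) \<Rightarrow> real \<Rightarrow> real
    \<Rightarrow> complex ^ 'n ^ 'n"
where
  "M_matrix b1 b2 z \<kappa> \<epsilon> x t = (\<chi> i j.
     1 / (\<kappa> j - cnj (\<kappa> i)) *
     (cnj (\<kappa> i) * exp (vartheta b1 b2 (z j) (\<kappa> j) x t + cnj (vartheta b1 b2 (z i) (\<kappa> i) x t))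
      + (if i = j then of_real (\<epsilon> i * cmod (\<kappa> i)) else 0)))"

text \<open>The parameter \<open>b\<close> is \<open>b1\<close> for the matrix \<open>H\<^sub>1\<close> and \<open>b2\<close> for \<open>H\<^sub>2\<close>.\<close>

definition H_matrix ::
  "real \<Rightarrow> real \<Rightarrow> real \<Rightarrow> ('n::finite \<Rightarrow> real) \<Rightarrow> ('n \<Rightarrow> complex) \<Rightarrow> ('n \<Rightarrow> real) \<Rightarrow> real \<Rightarrow> real
    \<Rightarrow> complex ^ 'n ^ 'n"
where
  "H_matrix b b1 b2 z \<kappa> \<epsilon> x t = (\<chi> i j.
     1 / (\<kappa> j - cnj (\<kappa> i)) *
     ((cnj (\<kappa> i) + of_real b) / (\<kappa> j + of_real b) * \<kappa> j
        * exp (vartheta b1 b2 (z j) (\<kappa> j) x t + cnj (vartheta b1 b2 (z i) (\<kappa> i) x t))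
      + (if i = j then of_real (\<epsilon> i * cmod (\<kappa> i)) else 0)))"

definition soliton_u1 ::
  "real \<Rightarrow> real \<Rightarrow> real \<Rightarrow> real \<Rightarrow> real \<Rightarrow> ('n::finite \<Rightarrow> real) \<Rightarrow> ('n \<Rightarrow> complex) \<Rightarrow> ('n \<Rightarrow> real)
    \<Rightarrow> real \<Rightarrow> real \<Rightarrow> complex"
where
  "soliton_u1 \<sigma> a1 a2 b1 b2 z \<kappa> \<epsilon> x t =
     of_real a1 * (det (H_matrix b1 b1 b2 z \<kappa> \<epsilon> x t) / det (M_matrix b1 b2 z \<kappa> \<epsilon> x t))
     * exp (\<i> * of_real (omega1 \<sigma> a1 a2 b1 b2 x t))"

definition soliton_u2 ::
  "real \<Rightarrow> real \<Rightarrow> real \<Rightarrow> real \<Rightarrow> real \<Rightarrow> ('n::finite \<Rightarrow> real) \<Rightarrow> ('n \<Rightarrow> complex) \<Rightarrow> ('n \<Rightarrow> real)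
    \<Rightarrow> real \<Rightarrow> real \<Rightarrow> complex"
where
  "soliton_u2 \<sigma> a1 a2 b1 b2 z \<kappa> \<epsilon> x t =
     of_real a2 * (det (H_matrix b2 b1 b2 z \<kappa> \<epsilon> x t) / det (M_matrix b1 b2 z \<kappa> \<epsilon> x t))
     * exp (\<i> * of_real (omega2 \<sigma> a1 a2 b1 b2 x t))"

end

(*
  Multiplying M and H_s from both sides by unitary diagonal matrices removes the real parts of the
  phases and leaves r_j = exp (i (k_j x + g t / k_j)), with k_j for kappa_j, c_i the
  conjugate of r_i, and 2 g = 2 - a1^2 b1 - sigma a2^2 b2.  Let K = diag k_j, let L be its conjugate,
  and let S be the diagonal matrix of the sign terms.
  Then M solves the Sylvester equation  M K - L M = L c r + S,  M_x and M_t have rank one, and H_s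
  is a rank-one update of M, so that q_s = det H_s / det M = 1 + b_s r (K + b_s)^-1 M^-1 c.  With
  M^dagger = -(M + c r) the conjugate of q_s is rational in the same bilinear forms r f(K) M^-1 h(L) c.

  For the wave with parameter b, the linear terms of the equation equal g F(0), and the interaction
  with the component s equals a_s^2 b_s F(b_s) / 2 (with sigma in front of a_2^2), where
     F(beta) = b (1 - p) T(beta) - q_b W(beta),
     p = r (K + b)^-1 M^-1 L c,
     T(beta) = r M^-1 S (K + beta)^-1 (L + beta)^-1 M^-1 c,
     W(beta) = r (K + beta)^-1 M^-1 S M^-1 L (L + beta)^-1 c.
  The condition on kappa_j says that the partial fraction  2 g / k + sum_s a_s^2 b_s / (k + b_s)
  takes the real value 1 / z_j at k = k_j and therefore at the conjugate of k_j too.  Hence the weighted sum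
  of the T(beta) vanishes termwise, while that of the W(beta) is
  trace (M^-1 S M^-1 [Z^-1 M - M Z^-1]) = 0, because S and Z are diagonal.
*)

theory Submission
  imports Defs
begin

section \<open>Bilinear forms of a Cauchy-type matrix\<close>

definition bil :: "complex^'n^'n \<Rightarrow> ('n::finite \<Rightarrow> complex) \<Rightarrow> ('n \<Rightarrow> complex) \<Rightarrow> complex" where
  "bil P v x = (\<Sum>k\<in>UNIV. v k * (\<Sum>j\<in>UNIV. P $ k $ j * x j))"

text \<open>With \<open>v\<close> as a row and \<open>x\<close> as a column this is v P diag(s) P x.
  Such forms arise when the diagonal part of a displacement equation for \<open>M\<close> is
  enclosed between two copies of \<open>P\<close>.\<close>

definition tri :: "complex^'n^'n \<Rightarrow> ('n::finite \<Rightarrow> complex) \<Rightarrow> ('n \<Rightarrow> complex) \<Rightarrow> ('n \<Rightarrow> complex) \<Rightarrow> complex" where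
  "tri P v s x = (\<Sum>k\<in>UNIV. (\<Sum>i\<in>UNIV. v i * P $ i $ k) * s k * (\<Sum>j\<in>UNIV. P $ k $ j * x j))"

lemma bil_row: "bil P v x = (\<Sum>k\<in>UNIV. (\<Sum>i\<in>UNIV. v i * P $ i $ k) * x k)"
proof -
  have "bil P v x = (\<Sum>i\<in>UNIV. \<Sum>k\<in>UNIV. v i * P $ i $ k * x k)"
    unfolding bil_def by (simp add: sum_distrib_left mult.assoc)
  also have "\<dots> = (\<Sum>k\<in>UNIV. \<Sum>i\<in>UNIV. v i * P $ i $ k * x k)" by (rule sum.swap)
  finally show ?thesis by (simp add: sum_distrib_right)
qed

lemma tri_eq_bil_row: "tri P v s x = bil P (\<lambda>k. (\<Sum>i\<in>UNIV. v i * P $ i $ k) * s k) x"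
  unfolding tri_def bil_def ..

lemma tri_eq_bil_col: "tri P v s x = bil P v (\<lambda>k. s k * (\<Sum>j\<in>UNIV. P $ k $ j * x j))"
  unfolding tri_def bil_row by (simp add: mult.assoc)

lemma bil_add_left: "bil P (\<lambda>i. v i + w i) x = bil P v x + bil P w x"
  unfolding bil_def by (simp add: distrib_right sum.distrib)

lemma bil_add_right: "bil P v (\<lambda>i. x i + y i) = bil P v x + bil P v y"
  unfolding bil_row by (simp add: distrib_left sum.distrib)

lemma bil_scale_left: "bil P (\<lambda>i. a * v i) x = a * bil P v x"
  unfolding bil_def by (simp add: sum_distrib_left mult.assoc)

lemma bil_scale_right: "bil P v (\<lambda>i. a * x i) = a * bil P v x"
  unfolding bil_row by (simp add: sum_distrib_left mult_ac)

section \<open>Displacement relations for the inverse of a Cauchy-type matrix\<close>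

locale cauchy_system =
  fixes \<kappa> \<mu> r c S :: "'n::finite \<Rightarrow> complex" and M P :: "complex^'n^'n"
  assumes MP: "M ** P = mat 1" and PM: "P ** M = mat 1"
    and sylvester: "\<And>i j. M $ i $ j * \<kappa> j = \<mu> i * M $ i $ j + \<mu> i * c i * r j + (if i = j then S i else 0)"
begin

lemma MP_nth: "(\<Sum>k\<in>UNIV. M $ i $ k * P $ k $ j) = (if i = j then 1 else 0)"
  using MP by (simp add: matrix_matrix_mult_def mat_def vec_eq_iff)

lemma PM_nth: "(\<Sum>k\<in>UNIV. P $ i $ k * M $ k $ j) = (if i = j then 1 else 0)"
  using PM by (simp add: matrix_matrix_mult_def mat_def vec_eq_iff)

lemma M_col: "(\<Sum>j\<in>UNIV. M $ i $ j * (\<Sum>l\<in>UNIV. P $ j $ l * x l)) = x i"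
proof -
  have "(\<Sum>j\<in>UNIV. M $ i $ j * (\<Sum>l\<in>UNIV. P $ j $ l * x l)) = (\<Sum>j\<in>UNIV. \<Sum>l\<in>UNIV. M $ i $ j * P $ j $ l * x l)"
    by (simp add: sum_distrib_left mult.assoc)
  also have "\<dots> = (\<Sum>l\<in>UNIV. \<Sum>j\<in>UNIV. M $ i $ j * P $ j $ l * x l)" by (rule sum.swap)
  also have "\<dots> = (\<Sum>l\<in>UNIV. (if i = l then 1 else 0) * x l)"
    by (simp only: sum_distrib_right[symmetric] MP_nth)
  also have "\<dots> = x i" by (simp add: if_distrib[of "\<lambda>u. u * _"] cong: if_cong)
  finally show ?thesis .
qed

lemma row_M: "(\<Sum>i\<in>UNIV. (\<Sum>k\<in>UNIV. v k * P $ k $ i) * M $ i $ j) = v j"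
proof -
  have "(\<Sum>i\<in>UNIV. (\<Sum>k\<in>UNIV. v k * P $ k $ i) * M $ i $ j) = (\<Sum>i\<in>UNIV. \<Sum>k\<in>UNIV. v k * (P $ k $ i * M $ i $ j))"
    by (simp add: sum_distrib_right mult.assoc)
  also have "\<dots> = (\<Sum>k\<in>UNIV. \<Sum>i\<in>UNIV. v k * (P $ k $ i * M $ i $ j))" by (rule sum.swap)
  also have "\<dots> = (\<Sum>k\<in>UNIV. v k * (if k = j then 1 else 0))"
    by (simp only: sum_distrib_left[symmetric] PM_nth)
  finally show ?thesis by (simp add: if_distrib cong: if_cong)
qed

text \<open>Multiply M diag(h) - diag(k) M = a d + diag(s) by the row v P on the left and by the
  column P x on the right; in the first two terms P and M cancel. The relations for K and for (K +
  beta)^-1 below are its two instances.\<close>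

lemma displacement:
  assumes "\<And>i j. M $ i $ j * h j = k i * M $ i $ j + a i * d j + (if i = j then s i else 0)"
  shows "bil P (\<lambda>i. v i * h i) x = bil P v (\<lambda>i. k i * x i) + bil P v a * bil P d x + tri P v s x"
proof -
  define X where "X j = (\<Sum>l\<in>UNIV. P $ j $ l * x l)" for j
  define V where "V i = (\<Sum>k\<in>UNIV. v k * P $ k $ i)" for i
  \<comment> \<open>The row v is written as V M, which brings in the entries of M governed by the
    hypothesis.\<close>
  have "bil P (\<lambda>i. v i * h i) x = (\<Sum>j\<in>UNIV. \<Sum>i\<in>UNIV. V i * M $ i $ j * h j * X j)"
    by (simp add: bil_def X_def[symmetric] sum_distrib_right[symmetric] row_M V_def)
  also have "\<dots> = (\<Sum>j\<in>UNIV. \<Sum>i\<in>UNIV. V i * k i * (M $ i $ j * X j) + (V i * a i) * (d j * X j)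
      + (if i = j then V i * s i * X j else 0))"
  proof (intro sum.cong refl)
    fix i j
    show "V i * M $ i $ j * h j * X j = V i * k i * (M $ i $ j * X j) + (V i * a i) * (d j * X j)
      + (if i = j then V i * s i * X j else 0)"
      using arg_cong[OF assms[of i j], of "\<lambda>u. V i * X j * u"]
      by (cases "i = j") (simp_all add: algebra_simps)
  qed
  also have "\<dots> = (\<Sum>j\<in>UNIV. \<Sum>i\<in>UNIV. V i * k i * (M $ i $ j * X j)) + (\<Sum>j\<in>UNIV. \<Sum>i\<in>UNIV. (V i * a i) * (d j * X j))
      + (\<Sum>j\<in>UNIV. V j * s j * X j)"
    by (simp add: sum.distrib)
  also have "(\<Sum>j\<in>UNIV. \<Sum>i\<in>UNIV. V i * k i * (M $ i $ j * X j)) = (\<Sum>i\<in>UNIV. \<Sum>j\<in>UNIV. V i * k i * (M $ i $ j * X j))"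
    by (rule sum.swap)
  also have "\<dots> = bil P v (\<lambda>i. k i * x i)"
    by (simp add: sum_distrib_left[symmetric] X_def M_col bil_row V_def[symmetric] mult.assoc)
  also have "(\<Sum>j\<in>UNIV. \<Sum>i\<in>UNIV. (V i * a i) * (d j * X j)) = bil P v a * bil P d x"
    by (subst sum.swap) (simp add: bil_row[of P v] bil_def[of P d] X_def V_def sum_product)
  also have "(\<Sum>j\<in>UNIV. V j * s j * X j) = tri P v s x"
    by (simp add: tri_def V_def X_def)
  finally show ?thesis .
qed

lemma bil_mult_kappa:
  "bil P (\<lambda>i. v i * \<kappa> i) x
    = bil P v (\<lambda>i. \<mu> i * x i) + bil P v (\<lambda>i. \<mu> i * c i) * bil P r x + tri P v S x"
  by (rule displacement) (rule sylvester)

text \<open>Enclosing the Sylvester equation between (L + beta)^-1 and (K + beta)^-1 gives a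
  displacement equation for the inverses. \<open>displacement\<close> is applied to -1/(K + beta)
  and -1/(L + beta), so that the rank-one term and S keep their signs.\<close>

lemma bil_div_kappa:
  assumes "\<And>i. \<kappa> i + \<beta> \<noteq> 0" "\<And>i. \<mu> i + \<beta> \<noteq> 0"
  shows "bil P v (\<lambda>i. x i / (\<mu> i + \<beta>)) = bil P (\<lambda>i. v i / (\<kappa> i + \<beta>)) x
    + bil P v (\<lambda>i. \<mu> i * c i / (\<mu> i + \<beta>)) * bil P (\<lambda>i. r i / (\<kappa> i + \<beta>)) x
    + tri P v (\<lambda>i. S i / ((\<kappa> i + \<beta>) * (\<mu> i + \<beta>))) x"
proof -
  have "bil P (\<lambda>i. v i * (- 1 / (\<kappa> i + \<beta>))) x = bil P v (\<lambda>i. (- 1 / (\<mu> i + \<beta>)) * x i)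
    + bil P v (\<lambda>i. \<mu> i * c i / (\<mu> i + \<beta>)) * bil P (\<lambda>i. r i / (\<kappa> i + \<beta>)) x
    + tri P v (\<lambda>i. S i / ((\<kappa> i + \<beta>) * (\<mu> i + \<beta>))) x"
  proof (rule displacement)
    fix i j
    have n: "\<kappa> j + \<beta> \<noteq> 0" "\<mu> i + \<beta> \<noteq> 0" using assms by auto
    define e where "e = (if i = j then S i else 0)"
    have e': "(if i = j then S i / ((\<kappa> i + \<beta>) * (\<mu> i + \<beta>)) else 0) = e / ((\<kappa> j + \<beta>) * (\<mu> i + \<beta>))"
      by (simp add: e_def)
    have s: "M $ i $ j * \<kappa> j = \<mu> i * M $ i $ j + \<mu> i * c i * r j + e"
      using sylvester e_def by simp
    have "M $ i $ j * (- 1 / (\<kappa> j + \<beta>)) - (- 1 / (\<mu> i + \<beta>)) * M $ i $ j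
        = (M $ i $ j * \<kappa> j - \<mu> i * M $ i $ j) / ((\<kappa> j + \<beta>) * (\<mu> i + \<beta>))"
      using n by (simp add: divide_simps) (simp add: algebra_simps)
    also have "\<dots> = (\<mu> i * c i * r j + e) / ((\<kappa> j + \<beta>) * (\<mu> i + \<beta>))"
      using s by simp
    also have "\<dots> = \<mu> i * c i / (\<mu> i + \<beta>) * (r j / (\<kappa> j + \<beta>)) + e / ((\<kappa> j + \<beta>) * (\<mu> i + \<beta>))"
      using n by (simp add: divide_simps)
    finally show "M $ i $ j * (- 1 / (\<kappa> j + \<beta>)) = (- 1 / (\<mu> i + \<beta>)) * M $ i $ j
        + \<mu> i * c i / (\<mu> i + \<beta>) * (r j / (\<kappa> j + \<beta>))
        + (if i = j then S i / ((\<kappa> i + \<beta>) * (\<mu> i + \<beta>)) else 0)"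
      unfolding e' by (simp add: algebra_simps)
  qed
  moreover have "bil P (\<lambda>i. v i * (- 1 / (\<kappa> i + \<beta>))) x = - bil P (\<lambda>i. v i / (\<kappa> i + \<beta>)) x"
    using bil_scale_left[of P "-1" "\<lambda>i. v i / (\<kappa> i + \<beta>)" x] by simp
  moreover have "bil P v (\<lambda>i. (- 1 / (\<mu> i + \<beta>)) * x i) = - bil P v (\<lambda>i. x i / (\<mu> i + \<beta>))"
    using bil_scale_right[of P v "-1" "\<lambda>i. x i / (\<mu> i + \<beta>)"] by simp
  ultimately show ?thesis by algebra
qed

section \<open>Scalar quantities attached to the system and their algebraic relations\<close>

definition g where "g = bil P r c"
definition q where "q b = 1 + b * bil P (\<lambda>i. r i / (\<kappa> i + b)) c"
text \<open>A rational expression without conjugation, which \<open>cnj_q\<close> identifies with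
  the conjugate of \<open>q b\<close> for real \<open>b\<close> in the Hermitian case. The
  identities below thus stay purely algebraic in \<open>\<kappa>\<close>, \<open>\<mu>\<close>,
  \<open>r\<close> and \<open>c\<close>.\<close>

definition qc where "qc b = 1 - b * bil P r (\<lambda>i. c i / (\<mu> i + b)) / (1 + g)"
text \<open>Up to the factor i b this is the x-derivative of \<open>q b\<close> (see
  \<open>Q_x\<close>), so \<open>q b + y b\<close> is the amplitude of the x-derivative of the
  modulated plane wave.\<close>

definition y where "y b = tri P (\<lambda>i. r i / (\<kappa> i + b)) S c"
definition p where "p b = bil P (\<lambda>i. r i / (\<kappa> i + b)) (\<lambda>i. \<mu> i * c i)"
definition T where "T b = tri P r (\<lambda>i. S i / ((\<kappa> i + b) * (\<mu> i + b))) c"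
definition W where "W b = tri P (\<lambda>i. r i / (\<kappa> i + b)) S (\<lambda>i. \<mu> i * c i / (\<mu> i + b))"

lemma bil_r_kappa:
  assumes "\<And>i. \<kappa> i + b \<noteq> 0"
  shows "bil P (\<lambda>i. r i / (\<kappa> i + b) * \<kappa> i) x = bil P r x - b * bil P (\<lambda>i. r i / (\<kappa> i + b)) x"
proof -
  have "(\<lambda>i. r i / (\<kappa> i + b) * \<kappa> i) = (\<lambda>i. r i + (- b) * (r i / (\<kappa> i + b)))"
    using assms by (auto simp: fun_eq_iff divide_simps) (simp add: algebra_simps)
  then show ?thesis by (simp only: bil_add_left bil_scale_left) simp
qed

lemma bil_mu_c:
  assumes "\<And>i. \<mu> i + b \<noteq> 0"
  shows "bil P v (\<lambda>i. \<mu> i * c i / (\<mu> i + b)) = bil P v c - b * bil P v (\<lambda>i. c i / (\<mu> i + b))"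
proof -
  have "(\<lambda>i. \<mu> i * c i / (\<mu> i + b)) = (\<lambda>i. c i + (- b) * (c i / (\<mu> i + b)))"
    using assms by (auto simp: fun_eq_iff divide_simps) (simp add: algebra_simps)
  then show ?thesis by (simp only: bil_add_right bil_scale_right) simp
qed

text \<open>This is \<open>bil_mult_kappa\<close> for the row r (K + b)^-1 and the column c, with k
  / (k + b) = 1 - b / (k + b) on the left-hand side.\<close>

lemma q_plus_y:
  assumes "\<And>i. \<kappa> i + b \<noteq> 0"
  shows "q b + y b = (1 + g) * (1 - p b)"
proof -
  have "g - b * bil P (\<lambda>i. r i / (\<kappa> i + b)) c = p b + p b * g + y b"
    using bil_mult_kappa[of "\<lambda>i. r i / (\<kappa> i + b)" c] bil_r_kappa[OF assms, of c]
    unfolding g_def p_def y_def by simp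
  then show ?thesis unfolding q_def by algebra
qed

text \<open>Two displacement relations for r P (L + beta)^-1 c give 1 - q qc = beta T / (1 + g) at
  \<open>\<beta>\<close>. By \<open>q_plus_y\<close> at \<open>b\<close>, the first product on the
  left is then beta b (1 - p b) T + beta^2 (q b) T / (1 + g), and the last summand of this cancels
  because qc y = W + beta T / (1 + g) at \<open>\<beta>\<close>.\<close>

lemma component_identity:
  assumes b: "\<And>i. \<kappa> i + b \<noteq> 0"
    and \<beta>: "\<And>i. \<kappa> i + \<beta> \<noteq> 0" "\<And>i. \<mu> i + \<beta> \<noteq> 0" and g: "1 + g \<noteq> 0"
  shows "(1 - q \<beta> * qc \<beta>) * ((b + \<beta>) * q b + b * y b) - \<beta> * q b * qc \<beta> * y \<beta>
    = \<beta> * (b * (1 - p b) * T \<beta> - q b * W \<beta>)"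
proof -
  let ?R = "\<lambda>i. r i / (\<kappa> i + \<beta>)" and ?C = "\<lambda>i. c i / (\<mu> i + \<beta>)"
  define rC where "rC = bil P r ?C"
  define Rc where "Rc = bil P ?R c"
  define Q where "Q = tri P ?R S ?C"
  have "bil P (\<lambda>i. ?R i * \<kappa> i) ?C = bil P ?R (\<lambda>i. \<mu> i * ?C i) + p \<beta> * rC + Q"
    using bil_mult_kappa[of ?R ?C] unfolding p_def rC_def Q_def .
  then have 1: "rC = Rc + p \<beta> * rC + Q"
    using bil_r_kappa[OF \<beta>(1), of ?C] bil_mu_c[OF \<beta>(2), of ?R]
    unfolding rC_def Rc_def by (simp add: algebra_simps)
  have 2: "q \<beta> + y \<beta> = (1 + g) * (1 - p \<beta>)" by (rule q_plus_y[OF \<beta>(1)])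
  have qyb: "q b + y b = (1 + g) * (1 - p b)" by (rule q_plus_y[OF b])
  have 3: "q \<beta> = 1 + \<beta> * Rc" by (simp add: q_def Rc_def)
  have 4: "rC = Rc + (g - \<beta> * rC) * Rc + T \<beta>"
    using bil_div_kappa[OF \<beta>, where v=r and x=c] bil_mu_c[OF \<beta>(2), of r]
    unfolding rC_def Rc_def T_def g_def by simp
  have 5: "W \<beta> = y \<beta> - \<beta> * Q"
    using bil_mu_c[OF \<beta>(2), of "\<lambda>k. (\<Sum>i\<in>UNIV. ?R i * P $ i $ k) * S k"]
    unfolding W_def y_def Q_def tri_eq_bil_row .
  define u where "u = inverse (1 + g)"
  have u: "u * (1 + g) = 1" using g by (simp add: u_def)
  have 6: "qc \<beta> = 1 - \<beta> * rC * u" by (simp add: qc_def rC_def u_def divide_inverse)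
  \<comment> \<open>By 2, 1 - p equals (q + y) u; inserting this in 1 expresses q rC u through Rc, Q
    and y, and Rc cancels.\<close>
  have 7: "1 - q \<beta> * qc \<beta> = \<beta> * (Q - y \<beta> * rC * u)"
    using 1 2 3 6 u by algebra
  have 8: "(1 + g) * Q - y \<beta> * rC = T \<beta>"
    using 1 2 3 4 by algebra
  show ?thesis
    using 7 8 5 6 qyb u by algebra
qed

text \<open>The counterpart of \<open>component_identity\<close> at the pole 0, where the t-flow
  takes the place of the interaction. The inverse displacement at 0, with the row R S, and the
  displacement by K, with the column \<open>x\<close>, share two terms; eliminating these leaves the
  claim.\<close>

lemma flow_identity:
  assumes b: "\<And>i. \<kappa> i + b \<noteq> 0"
    and k0: "\<And>i. \<kappa> i \<noteq> 0" "\<And>i. \<mu> i \<noteq> 0"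
  shows "tri P (\<lambda>i. r i / (\<kappa> i + b)) S (\<lambda>i. c i / \<mu> i) - y b * bil P (\<lambda>i. r i / \<kappa> i) c
      + b * tri P (\<lambda>i. r i / (\<kappa> i + b)) (\<lambda>i. S i / (\<kappa> i * \<mu> i)) c = (1 - p b) * T 0"
proof -
  let ?R = "\<lambda>i. r i / (\<kappa> i + b)" and ?S = "\<lambda>i. S i / (\<kappa> i * \<mu> i)"
  define R where "R k = (\<Sum>i\<in>UNIV. ?R i * P $ i $ k)" for k
  define \<phi> where "\<phi> k = (\<Sum>j\<in>UNIV. P $ k $ j * c j)" for k
  \<comment> \<open>This column makes R P S P diag(S / (K L)) P c equal to R P S P x, and R S K^-1 P
    c equal to R P L x: exactly the terms that \<open>bil_mult_kappa\<close> produces for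
    \<open>x\<close>.\<close>
  define x where "x k = ?S k * \<phi> k" for k
  have "bil P (\<lambda>k. R k * S k) (\<lambda>i. c i / (\<mu> i + 0)) = bil P (\<lambda>k. R k * S k / (\<kappa> k + 0)) c
     + bil P (\<lambda>k. R k * S k) (\<lambda>i. \<mu> i * c i / (\<mu> i + 0)) * bil P (\<lambda>i. r i / (\<kappa> i + 0)) c
     + tri P (\<lambda>k. R k * S k) (\<lambda>i. S i / ((\<kappa> i + 0) * (\<mu> i + 0))) c"
    by (rule bil_div_kappa) (use k0 in auto)
  then have 1: "tri P ?R S (\<lambda>i. c i / \<mu> i) = bil P (\<lambda>k. R k * S k / \<kappa> k) c
     + y b * bil P (\<lambda>i. r i / \<kappa> i) c + tri P (\<lambda>k. R k * S k) ?S c"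
    using k0 by (simp add: tri_eq_bil_row[of P ?R] y_def R_def)
  have 2: "tri P (\<lambda>k. R k * S k) ?S c = tri P ?R S x"
    unfolding tri_eq_bil_col[of P _ ?S] tri_eq_bil_row[of P _ S] R_def[symmetric] \<phi>_def[symmetric] x_def[symmetric] ..
  have 3: "bil P (\<lambda>k. R k * S k / \<kappa> k) c = bil P ?R (\<lambda>k. \<mu> k * x k)"
    unfolding bil_row[of P ?R] bil_def[of P _ c]
    by (rule sum.cong) (use k0 in \<open>auto simp: x_def R_def \<phi>_def\<close>)
  have 4: "tri P ?R ?S c = bil P ?R x"
    unfolding tri_eq_bil_col \<phi>_def[symmetric] x_def[symmetric] ..
  have 5: "T 0 = bil P r x"
    unfolding T_def tri_eq_bil_col \<phi>_def[symmetric] by (simp add: x_def[abs_def])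
  have "bil P r x - b * bil P ?R x = bil P ?R (\<lambda>k. \<mu> k * x k) + p b * bil P r x + tri P ?R S x"
    using bil_mult_kappa[of ?R x] bil_r_kappa[OF b, of x] by (simp add: p_def)
  then show ?thesis
    using 1 2 3 4 5 by algebra
qed

section \<open>Vanishing of the spectrally weighted sums of T and W\<close>

lemma bil_weighted_sum:
  assumes "finite B"
  shows "(\<Sum>\<beta>\<in>B. w \<beta> * bil P v (x \<beta>)) = bil P v (\<lambda>k. \<Sum>\<beta>\<in>B. w \<beta> * x \<beta> k)"
proof -
  define V where "V k = (\<Sum>i\<in>UNIV. v i * P $ i $ k)" for k
  have "(\<Sum>\<beta>\<in>B. w \<beta> * bil P v (x \<beta>)) = (\<Sum>\<beta>\<in>B. \<Sum>k\<in>UNIV. V k * (w \<beta> * x \<beta> k))"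
    by (simp add: bil_row V_def[symmetric] sum_distrib_left mult_ac)
  also have "\<dots> = (\<Sum>k\<in>UNIV. \<Sum>\<beta>\<in>B. V k * (w \<beta> * x \<beta> k))"
    by (rule sum.swap)
  finally show ?thesis by (simp add: bil_row V_def[symmetric] sum_distrib_left)
qed

lemma partial_fraction_sum:
  assumes "finite B" and "\<And>\<beta>. \<beta> \<in> B \<Longrightarrow> s + \<beta> \<noteq> 0" "\<And>\<beta>. \<beta> \<in> B \<Longrightarrow> t + \<beta> \<noteq> 0"
  shows "(s - t) * (\<Sum>\<beta>\<in>B. w \<beta> / ((s + \<beta>) * (t + \<beta>))) = (\<Sum>\<beta>\<in>B. w \<beta> / (t + \<beta>)) - (\<Sum>\<beta>\<in>B. w \<beta> / (s + \<beta> :: complex))"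
  unfolding sum_subtractf[symmetric] sum_distrib_left
  by (rule sum.cong) (use assms in \<open>auto simp: divide_simps algebra_simps\<close>)

context
  fixes B :: "complex set" and w :: "complex \<Rightarrow> complex" and \<zeta> :: "'n \<Rightarrow> complex"
  assumes fin: "finite B"
    and nz: "\<And>i \<beta>. \<beta> \<in> B \<Longrightarrow> \<kappa> i + \<beta> \<noteq> 0" "\<And>i \<beta>. \<beta> \<in> B \<Longrightarrow> \<mu> i + \<beta> \<noteq> 0"
    and disj: "\<And>i j. \<kappa> i \<noteq> \<mu> j"
    and spec: "\<And>i. (\<Sum>\<beta>\<in>B. w \<beta> / (\<kappa> i + \<beta>)) = \<zeta> i" "\<And>i. (\<Sum>\<beta>\<in>B. w \<beta> / (\<mu> i + \<beta>)) = \<zeta> i"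
begin

text \<open>The partial fraction has the same value \<open>\<zeta> i\<close> at
  \<open>\<kappa> i\<close> and at \<open>\<mu> i\<close>, so the divided difference depends on the
  indices only through \<open>\<zeta>\<close> and vanishes for i = j.\<close>

lemma spectral_fraction: "(\<Sum>\<beta>\<in>B. w \<beta> / ((\<kappa> i + \<beta>) * (\<mu> j + \<beta>))) = (\<zeta> j - \<zeta> i) / (\<kappa> i - \<mu> j)"
  using partial_fraction_sum[OF fin, of "\<kappa> i" "\<mu> j" w] nz disj[of i j] spec
  by (simp add: field_simps)

text \<open>T contains only the products (k_i + beta)(mu_i + beta) with equal indices, for which
  \<open>spectral_fraction\<close> is zero.\<close>

lemma weighted_T_sum: "(\<Sum>\<beta>\<in>B. w \<beta> * T \<beta>) = 0"
proof -
  have "(\<Sum>\<beta>\<in>B. w \<beta> * (S k / ((\<kappa> k + \<beta>) * (\<mu> k + \<beta>)) * f)) = 0" for k f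
  proof -
    have "(\<Sum>\<beta>\<in>B. w \<beta> * (S k / ((\<kappa> k + \<beta>) * (\<mu> k + \<beta>)) * f))
        = S k * f * (\<Sum>\<beta>\<in>B. w \<beta> / ((\<kappa> k + \<beta>) * (\<mu> k + \<beta>)))"
      by (simp add: sum_distrib_left mult_ac)
    then show ?thesis by (simp only: spectral_fraction) simp
  qed
  then show ?thesis
    unfolding T_def tri_eq_bil_col bil_weighted_sum[OF fin] by (simp add: bil_def)
qed

text \<open>With Q = P S P and Z^-1 = diag(zeta), the sum becomes the trace of Q (Z^-1 M - M Z^-1).
  Since Q M = P S and M Q = S P, both halves equal the sum of zeta_i S_i P_ii.\<close>

lemma weighted_W_sum: "(\<Sum>\<beta>\<in>B. w \<beta> * W \<beta>) = 0"
proof -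
  define Q where "Q i j = (\<Sum>k\<in>UNIV. P $ i $ k * S k * P $ k $ j)" for i j
  have Wb: "W \<beta> = (\<Sum>i\<in>UNIV. \<Sum>j\<in>UNIV. Q i j * (r i * \<mu> j * c j / ((\<kappa> i + \<beta>) * (\<mu> j + \<beta>))))" for \<beta>
  proof -
    define R C where "R i = r i / (\<kappa> i + \<beta>)" and "C j = \<mu> j * c j / (\<mu> j + \<beta>)" for i j
    have "W \<beta> = (\<Sum>k\<in>UNIV. \<Sum>i\<in>UNIV. \<Sum>j\<in>UNIV. R i * P $ i $ k * S k * (P $ k $ j * C j))"
      unfolding W_def tri_def R_def[symmetric] C_def[symmetric] sum_distrib_right
      unfolding sum_distrib_left by (simp add: mult_ac)
    also have "\<dots> = (\<Sum>i\<in>UNIV. \<Sum>k\<in>UNIV. \<Sum>j\<in>UNIV. R i * P $ i $ k * S k * (P $ k $ j * C j))"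
      by (rule sum.swap)
    also have "\<dots> = (\<Sum>i\<in>UNIV. \<Sum>j\<in>UNIV. \<Sum>k\<in>UNIV. R i * P $ i $ k * S k * (P $ k $ j * C j))"
      by (intro sum.cong refl sum.swap)
    also have "\<dots> = (\<Sum>i\<in>UNIV. \<Sum>j\<in>UNIV. Q i j * (R i * C j))"
      by (simp add: Q_def sum_distrib_left sum_distrib_right mult_ac)
    finally show ?thesis by (simp add: R_def C_def mult_ac)
  qed
  have "(\<Sum>\<beta>\<in>B. w \<beta> * W \<beta>) = (\<Sum>i\<in>UNIV. \<Sum>\<beta>\<in>B. \<Sum>j\<in>UNIV. w \<beta> * (Q i j * (r i * \<mu> j * c j / ((\<kappa> i + \<beta>) * (\<mu> j + \<beta>)))))"
    unfolding Wb sum_distrib_left by (rule sum.swap)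
  also have "\<dots> = (\<Sum>i\<in>UNIV. \<Sum>j\<in>UNIV. \<Sum>\<beta>\<in>B. w \<beta> * (Q i j * (r i * \<mu> j * c j / ((\<kappa> i + \<beta>) * (\<mu> j + \<beta>)))))"
    by (intro sum.cong refl sum.swap)
  also have "\<dots> = (\<Sum>i\<in>UNIV. \<Sum>j\<in>UNIV. Q i j * M $ j $ i * (\<zeta> j - \<zeta> i))"
  proof (intro sum.cong refl)
    fix i j
    have "(\<Sum>\<beta>\<in>B. w \<beta> * (Q i j * (r i * \<mu> j * c j / ((\<kappa> i + \<beta>) * (\<mu> j + \<beta>)))))
        = Q i j * (r i * \<mu> j * c j) * (\<Sum>\<beta>\<in>B. w \<beta> / ((\<kappa> i + \<beta>) * (\<mu> j + \<beta>)))"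
      by (simp add: sum_distrib_left mult_ac)
    also have "\<dots> = Q i j * (r i * \<mu> j * c j) * ((\<zeta> j - \<zeta> i) / (\<kappa> i - \<mu> j))"
      by (simp only: spectral_fraction)
    also have "\<dots> = Q i j * M $ j $ i * (\<zeta> j - \<zeta> i)"
    \<comment> \<open>Off the diagonal the Sylvester equation has no S term and the denominator
      cancels. On the diagonal both sides are zero because the zeta values coincide.\<close>
    proof (cases "i = j")
      case False
      then have "r i * \<mu> j * c j = M $ j $ i * (\<kappa> i - \<mu> j)"
        using sylvester[of j i] by (simp add: algebra_simps)
      then show ?thesis using disj[of i j] by simp
    qed simp
    finally show "(\<Sum>\<beta>\<in>B. w \<beta> * (Q i j * (r i * \<mu> j * c j / ((\<kappa> i + \<beta>) * (\<mu> j + \<beta>)))))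
        = Q i j * M $ j $ i * (\<zeta> j - \<zeta> i)" .
  qed
  also have "\<dots> = (\<Sum>i\<in>UNIV. \<Sum>j\<in>UNIV. Q i j * M $ j $ i * \<zeta> j) - (\<Sum>i\<in>UNIV. \<Sum>j\<in>UNIV. Q i j * M $ j $ i * \<zeta> i)"
    by (simp add: right_diff_distrib sum_subtractf)
  \<comment> \<open>Summing over j first turns P S P M into P S; the companion sum below is taken
    over i first and turns M P S P into S P.\<close>
  also have "(\<Sum>i\<in>UNIV. \<Sum>j\<in>UNIV. Q i j * M $ j $ i * \<zeta> i) = (\<Sum>i\<in>UNIV. \<zeta> i * S i * P $ i $ i)"
  proof -
    have "(\<Sum>j\<in>UNIV. Q i j * M $ j $ i * \<zeta> i) = \<zeta> i * S i * P $ i $ i" for i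
      using row_M[of "\<lambda>k. P $ i $ k * S k" i] by (simp add: Q_def sum_distrib_right[symmetric])
    then show ?thesis by simp
  qed
  also have "(\<Sum>i\<in>UNIV. \<Sum>j\<in>UNIV. Q i j * M $ j $ i * \<zeta> j) = (\<Sum>j\<in>UNIV. \<Sum>i\<in>UNIV. Q i j * M $ j $ i * \<zeta> j)"
    by (rule sum.swap)
  also have "\<dots> = (\<Sum>i\<in>UNIV. \<zeta> i * S i * P $ i $ i)"
  proof -
    have "(\<Sum>i\<in>UNIV. Q i j * M $ j $ i * \<zeta> j) = \<zeta> j * S j * P $ j $ j" for j
      using M_col[of j "\<lambda>k. S k * P $ k $ j"]
      by (simp add: Q_def sum_distrib_left[symmetric] mult_ac)
    then show ?thesis by simp
  qed
  finally show ?thesis by simp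
qed

end

end

section \<open>The Hermitian reduction and complex conjugates of bilinear forms\<close>

locale hermitian_cauchy_system =
  cauchy_system \<kappa> "\<lambda>i. cnj (\<kappa> i)" r "\<lambda>i. cnj (r i)" S M P
  for \<kappa> r S :: "'n::finite \<Rightarrow> complex" and M P :: "complex^'n^'n" +
  assumes disjoint: "\<And>i j. \<kappa> i \<noteq> cnj (\<kappa> j)" and S_real: "\<And>i. cnj (S i) = S i"
begin

text \<open>The conjugate transpose of M satisfies a Sylvester equation with the same S. Adding the
  two equations cancels S, and the common factor is nonzero by \<open>disjoint\<close>.\<close>

lemma cnj_M: "cnj (M $ j $ i) = - (M $ i $ j + cnj (r i) * r j)"
proof -
  have 1: "cnj (M $ j $ i) * cnj (\<kappa> i) = \<kappa> j * cnj (M $ j $ i) + \<kappa> j * r j * cnj (r i) + (if i = j then S i else 0)"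
    using arg_cong[OF sylvester[of j i], of cnj] S_real by (auto split: if_splits)
  have 2: "M $ i $ j * \<kappa> j = cnj (\<kappa> i) * M $ i $ j + cnj (\<kappa> i) * cnj (r i) * r j + (if i = j then S i else 0)"
    by (rule sylvester)
  have "(\<kappa> j - cnj (\<kappa> i)) * (cnj (M $ j $ i) + M $ i $ j + cnj (r i) * r j) = 0"
    using 1 2 by algebra
  then have "cnj (M $ j $ i) + M $ i $ j + cnj (r i) * r j = 0" using disjoint by simp
  then show ?thesis by algebra
qed

text \<open>If 1 + g = 0, then by \<open>cnj_M\<close> the conjugate transpose of M annihilates P c.
  Invertibility of M forces P c = 0, hence g = 0, a contradiction.\<close>

lemma one_plus_g: "1 + g \<noteq> 0"
proof
  assume g0: "1 + g = 0"
  define \<phi> where "\<phi> k = (\<Sum>j\<in>UNIV. P $ k $ j * cnj (r j))" for k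
  have "(\<Sum>j\<in>UNIV. cnj (M $ j $ i) * \<phi> j) = 0" for i
  proof -
    have "(\<Sum>j\<in>UNIV. cnj (M $ j $ i) * \<phi> j) = - ((\<Sum>j\<in>UNIV. M $ i $ j * \<phi> j) + cnj (r i) * (\<Sum>j\<in>UNIV. r j * \<phi> j))"
      by (simp add: cnj_M sum.distrib sum_negf sum_subtractf algebra_simps sum_distrib_left)
    also have "\<dots> = - (cnj (r i) * (1 + g))"
      unfolding \<phi>_def M_col by (simp add: g_def bil_def algebra_simps)
    finally show ?thesis using g0 by simp
  qed
  moreover have "(\<Sum>j\<in>UNIV. cnj (\<phi> j) * M $ j $ i) = cnj (\<Sum>j\<in>UNIV. cnj (M $ j $ i) * \<phi> j)" for i
    by (simp add: mult.commute)
  ultimately have 0: "(\<Sum>j\<in>UNIV. cnj (\<phi> j) * M $ j $ i) = 0" for i by simp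
  have "cnj (\<phi> k) = 0" for k
  proof -
    have "cnj (\<phi> k) = (\<Sum>j\<in>UNIV. cnj (\<phi> j) * (\<Sum>i\<in>UNIV. M $ j $ i * P $ i $ k))"
      by (simp add: MP_nth if_distrib cong: if_cong)
    also have "\<dots> = (\<Sum>j\<in>UNIV. \<Sum>i\<in>UNIV. cnj (\<phi> j) * M $ j $ i * P $ i $ k)"
      by (simp add: sum_distrib_left mult.assoc)
    also have "\<dots> = (\<Sum>i\<in>UNIV. \<Sum>j\<in>UNIV. cnj (\<phi> j) * M $ j $ i * P $ i $ k)" by (rule sum.swap)
    also have "\<dots> = 0" by (simp add: sum_distrib_right[symmetric] 0)
    finally show ?thesis .
  qed
  then have "g = 0" by (simp add: g_def bil_def \<phi>_def[symmetric])
  then show False using g0 by simp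
qed

text \<open>Let w be the column of conjugates of v P. The conjugate transpose of M maps w to the
  conjugate of v, and by \<open>cnj_M\<close> it also maps w to -(M w + rho c), where rho = r w is
  the conjugate of v P c. Applying r P to both expressions gives the claim.\<close>

lemma cnj_bil: "cnj (bil P v (\<lambda>i. cnj (r i))) * (1 + g) = - bil P r (\<lambda>i. cnj (v i))"
proof -
  define w where "w j = (\<Sum>k\<in>UNIV. cnj (v k * P $ k $ j))" for j
  define \<rho> where "\<rho> = (\<Sum>j\<in>UNIV. r j * w j)"
  have "(\<Sum>j\<in>UNIV. cnj (M $ j $ i) * w j) = cnj (v i)" for i
    using arg_cong[OF row_M[of v i], of cnj] by (simp add: w_def mult.commute)
  moreover have "(\<Sum>j\<in>UNIV. cnj (M $ j $ i) * w j) = - ((\<Sum>j\<in>UNIV. M $ i $ j * w j) + cnj (r i) * \<rho>)" for i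
    by (simp add: cnj_M \<rho>_def sum.distrib sum_negf sum_subtractf algebra_simps sum_distrib_left)
  ultimately have Mw: "cnj (v i) = (-1) * ((\<Sum>j\<in>UNIV. M $ i $ j * w j) + \<rho> * cnj (r i))" for i
    by (simp add: mult.commute)
  have "bil P r (\<lambda>i. \<Sum>j\<in>UNIV. M $ i $ j * w j) = \<rho>"
  proof -
    have "bil P r (\<lambda>i. \<Sum>j\<in>UNIV. M $ i $ j * w j)
        = (\<Sum>i\<in>UNIV. \<Sum>j\<in>UNIV. (\<Sum>k\<in>UNIV. r k * P $ k $ i) * M $ i $ j * w j)"
      by (simp add: bil_row sum_distrib_left mult.assoc)
    also have "\<dots> = (\<Sum>j\<in>UNIV. \<Sum>i\<in>UNIV. (\<Sum>k\<in>UNIV. r k * P $ k $ i) * M $ i $ j * w j)"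
      by (rule sum.swap)
    finally show ?thesis by (simp add: sum_distrib_right[symmetric] row_M \<rho>_def)
  qed
  then have "bil P r (\<lambda>i. cnj (v i)) = - (\<rho> + \<rho> * g)"
    unfolding Mw bil_scale_right bil_add_right by (simp add: g_def algebra_simps)
  moreover have "cnj (bil P v (\<lambda>i. cnj (r i))) = \<rho>"
    by (simp add: bil_row \<rho>_def w_def mult.commute)
  ultimately show ?thesis by algebra
qed

lemma cnj_q:
  assumes "cnj b = b"
  shows "cnj (q b) = qc b"
proof -
  have "cnj (bil P (\<lambda>i. r i / (\<kappa> i + b)) (\<lambda>i. cnj (r i)))
      = - bil P r (\<lambda>i. cnj (r i) / (cnj (\<kappa> i) + b)) / (1 + g)"
    using cnj_bil[of "\<lambda>i. r i / (\<kappa> i + b)"] one_plus_g assms by (simp add: field_simps)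
  then show ?thesis using assms by (simp add: q_def qc_def)
qed

end

section \<open>Determinants and inverses of matrices\<close>

text \<open>As row k is \<open>v\<close> itself, the added multiples of \<open>v\<close> are row
  operations.\<close>

lemma det_row_replace_absorb:
  fixes A :: "'a::comm_ring_1^'n^'n" and v :: "'a^'n"
  assumes "finite F" "k \<notin> F"
  shows "det (\<chi> i. if i = k then v else if i \<in> F then A $ i + u i *s v else A $ i)
    = det (\<chi> i. if i = k then v else A $ i)"
  using assms
proof (induction F)
  case (insert l F)
  let ?B = "(\<chi> i. if i = k then v else if i \<in> F then A $ i + u i *s v else A $ i) :: 'a^'n^'n"
  have "det (\<chi> i. if i = l then row l ?B + u l *s row k ?B else row i ?B) = det ?B"
    by (rule det_row_operation) (use insert in auto)
  moreover have "(\<chi> i. if i = l then row l ?B + u l *s row k ?B else row i ?B)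
      = (\<chi> i. if i = k then v else if i \<in> insert l F then A $ i + u i *s v else A $ i)"
    using insert by (auto simp: vec_eq_iff row_def)
  ultimately show ?case using insert by simp
qed (simp cong: if_cong)

text \<open>Multilinearity in the rows: a term that takes \<open>v\<close> in two rows has
  determinant zero, so only the terms linear in \<open>u\<close> remain.\<close>

lemma det_rank_one_rows:
  fixes A :: "'a::comm_ring_1^'n^'n" and v :: "'a^'n"
  assumes "finite F"
  shows "det (\<chi> i. if i \<in> F then A $ i + u i *s v else A $ i)
    = det A + (\<Sum>k\<in>F. u k * det (\<chi> i. if i = k then v else A $ i))"
  using assms
proof (induction F)
  case empty
  then show ?case by (simp add: vec_lambda_eta)
next
  case (insert k F)
  let ?B = "\<lambda>i. if i \<in> F then A $ i + u i *s v else A $ i"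
  have "det (\<chi> i. if i \<in> insert k F then A $ i + u i *s v else A $ i)
      = det (\<chi> i. if i = k then A $ k + u k *s v else ?B i)"
    by (rule arg_cong[of _ _ det]) (auto simp: vec_eq_iff)
  also have "\<dots> = det (\<chi> i. if i = k then A $ k else ?B i) + det (\<chi> i. if i = k then u k *s v else ?B i)"
    by (rule det_row_add)
  also have "det (\<chi> i. if i = k then u k *s v else ?B i) = u k * det (\<chi> i. if i = k then v else ?B i)"
    by (rule det_row_mul)
  also have "det (\<chi> i. if i = k then v else ?B i) = det (\<chi> i. if i = k then v else A $ i)"
    by (rule det_row_replace_absorb) (use insert in auto)
  also have "(\<chi> i. if i = k then A $ k else ?B i) = (\<chi> i. ?B i)"
    using insert by (auto simp: vec_eq_iff)
  finally show ?case using insert by (simp add: algebra_simps)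
qed

lemma matrix_inv_mult:
  fixes A :: "complex^'n^'n"
  assumes "det A \<noteq> 0"
  shows "A ** matrix_inv A = mat 1" "matrix_inv A ** A = mat 1"
proof -
  have "invertible A" using assms by (simp add: invertible_det_nz)
  then have "A ** matrix_inv A = mat 1 \<and> matrix_inv A ** A = mat 1"
    unfolding invertible_def matrix_inv_def by (rule someI_ex)
  then show "A ** matrix_inv A = mat 1" "matrix_inv A ** A = mat 1" by auto
qed

text \<open>The matrix determinant lemma, which turns the quotient of det H by det M into one plus a
  bilinear form.\<close>

lemma det_rank_one_update:
  fixes A :: "complex^'n^'n"
  assumes "det A \<noteq> 0"
  shows "det (\<chi> i j. A $ i $ j + u i * v j) = det A * (1 + bil (matrix_inv A) v u)"
proof -
  let ?P = "matrix_inv A"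
  define w where "w = (\<chi> k. \<Sum>i\<in>UNIV. v i * ?P $ i $ k)"
  have PA: "(\<Sum>k\<in>UNIV. ?P $ i $ k * A $ k $ j) = (if i = j then 1 else 0)" for i j
    using matrix_inv_mult(2)[OF assms] by (simp add: matrix_matrix_mult_def mat_def vec_eq_iff)
  have wA: "(\<Sum>k\<in>UNIV. w $ k * A $ k $ j) = v j" for j
  proof -
    have "(\<Sum>k\<in>UNIV. w $ k * A $ k $ j) = (\<Sum>k\<in>UNIV. \<Sum>i\<in>UNIV. v i * (?P $ i $ k * A $ k $ j))"
      by (simp add: w_def sum_distrib_right mult.assoc)
    also have "\<dots> = (\<Sum>i\<in>UNIV. \<Sum>k\<in>UNIV. v i * (?P $ i $ k * A $ k $ j))" by (rule sum.swap)
    also have "\<dots> = (\<Sum>i\<in>UNIV. v i * (if i = j then 1 else 0))"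
      by (simp only: sum_distrib_left[symmetric] PA)
    finally show ?thesis by (simp add: if_distrib cong: if_cong)
  qed
  \<comment> \<open>The row v is the combination of the rows of A with coefficients w = v A^-1, so
    by Cramer's rule putting it in place of row k multiplies the determinant by w_k.\<close>
  have row: "det (\<chi> i. if i = k then vec_lambda v else A $ i) = w $ k * det A" for k
  proof -
    have "(\<Sum>i\<in>UNIV. w $ i *s row i A) = vec_lambda v"
      by (simp add: vec_eq_iff row_def wA)
    then show ?thesis using cramer_lemma_transpose[of k w A]
      by (simp add: row_def vec_lambda_eta cong: if_cong)
  qed
  have "det (\<chi> i j. A $ i $ j + u i * v j) = det (\<chi> i. if i \<in> UNIV then A $ i + u i *s vec_lambda v else A $ i)"
    by (rule arg_cong[of _ _ det]) (simp add: vec_eq_iff)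
  also have "\<dots> = det A + (\<Sum>k\<in>UNIV. u k * (w $ k * det A))"
    by (subst det_rank_one_rows) (simp_all add: row)
  also have "\<dots> = det A * (1 + bil ?P v u)"
    by (simp add: bil_row w_def sum_distrib_left algebra_simps)
  finally show ?thesis .
qed

lemma det_unitary_diagonal_conj:
  fixes A :: "complex^'n^'n"
  assumes "\<And>i. cnj (d i) * d i = 1"
  shows "det (\<chi> i j. cnj (d i) * A $ i $ j * d j) = det A"
proof -
  let ?B = "transpose (\<chi> i. d i *s transpose A $ i) :: complex^'n^'n"
  have "(\<chi> i j. cnj (d i) * A $ i $ j * d j) = (\<chi> i. cnj (d i) *s ?B $ i)"
    by (simp add: vec_eq_iff transpose_def mult_ac)
  then have "det (\<chi> i j. cnj (d i) * A $ i $ j * d j) = (\<Prod>i\<in>UNIV. cnj (d i)) * ((\<Prod>i\<in>UNIV. d i) * det A)"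
    by (simp only: det_rows_mul vec_lambda_eta det_transpose)
  then show ?thesis using assms by (simp add: prod.distrib[symmetric] mult.assoc[symmetric])
qed

section \<open>Continuity and differentiation of determinants and inverse matrices\<close>

lemma continuous_on_det:
  fixes A :: "'a::topological_space \<Rightarrow> complex^'n^'n"
  assumes "\<And>i j. continuous_on X (\<lambda>s. A s $ i $ j)"
  shows "continuous_on X (\<lambda>s. det (A s))"
  unfolding det_def by (intro continuous_intros assms)

lemma det_differentiable:
  fixes A :: "real \<Rightarrow> complex^'n^'n"
  assumes "\<And>i j. (\<lambda>s. A s $ i $ j) differentiable (at s)"
  shows "(\<lambda>s. det (A s)) differentiable (at s)"
proof -
  have "(\<lambda>s. \<Prod>i\<in>UNIV. A s $ i $ p i) differentiable (at s)" for p
  proof -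
    have "\<exists>D. \<forall>i j. ((\<lambda>s. A s $ i $ j) has_derivative D i j) (at s)"
      using assms unfolding differentiable_def by metis
    then obtain D where "\<And>i j. ((\<lambda>s. A s $ i $ j) has_derivative D i j) (at s)" by blast
    then show ?thesis
      using has_derivative_prod[of UNIV "\<lambda>i s. A s $ i $ p i" "\<lambda>i. D i (p i)" s UNIV]
      unfolding differentiable_def by blast
  qed
  then show ?thesis unfolding det_def by (intro differentiable_sum differentiable_mult) auto
qed

lemma matrix_inv_cramer:
  fixes A :: "complex^'n^'n"
  assumes "det A \<noteq> 0"
  shows "matrix_inv A $ i $ j
    = det (\<chi> k l. if l = i then (if k = j then 1 else 0) else A $ k $ l) / det A"
proof -
  have "A *v column j (matrix_inv A) = (\<chi> k. if k = j then 1 else 0)"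
    using matrix_inv_mult(1)[OF assms]
    by (simp add: matrix_vector_mult_def matrix_matrix_mult_def mat_def column_def vec_eq_iff)
  then have "column j (matrix_inv A)
      = (\<chi> i. det (\<chi> k l. if l = i then (\<chi> k. if k = j then 1 else 0) $ k else A $ k $ l) / det A)"
    by (subst (asm) cramer[OF assms])
  then show ?thesis by (simp add: vec_eq_iff column_def cong: if_cong)
qed

lemma eventually_det_nonzero:
  fixes A :: "real \<Rightarrow> complex^'n^'n"
  assumes "\<And>i j. (\<lambda>s. A s $ i $ j) differentiable (at s)" and "det (A s) \<noteq> 0"
  shows "\<forall>\<^sub>F s' in nhds s. det (A s') \<noteq> 0"
proof -
  have "isCont (\<lambda>s. det (A s)) s"
    using det_differentiable[OF assms(1)] by (rule differentiable_imp_continuous_within)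
  then have "\<forall>\<^sub>F s' in at s. det (A s') \<noteq> 0"
    using assms(2) by (intro tendsto_imp_eventually_ne) (auto simp: isCont_def)
  then show ?thesis using assms(2) by (simp add: eventually_nhds_conv_at)
qed

lemma has_vector_derivative_cong_nhds:
  assumes "\<forall>\<^sub>F s' in nhds s. f s' = g s'" and "(g has_vector_derivative d) (at s)"
  shows "(f has_vector_derivative d) (at s)"
proof -
  obtain U where U: "open U" "s \<in> U" "\<And>s'. s' \<in> U \<Longrightarrow> f s' = g s'"
    using assms(1) unfolding eventually_nhds by auto
  show ?thesis
    by (rule has_vector_derivative_transform_within_open[OF assms(2) U(1,2)]) (simp add: U)
qed

lemma matrix_inv_differentiable:
  fixes A :: "real \<Rightarrow> complex^'n^'n"
  assumes A: "\<And>i j. (\<lambda>s. A s $ i $ j) differentiable (at s)" and nz: "det (A s) \<noteq> 0"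
  shows "(\<lambda>s. matrix_inv (A s) $ i $ j) differentiable (at s)"
proof -
  let ?f = "\<lambda>s. det (\<chi> k l. if l = i then (if k = j then 1 else 0) else A s $ k $ l) / det (A s)"
  have "(\<lambda>s. (\<chi> k l. if l = i then (if k = j then 1 else 0) else A s $ k $ l) $ k $ l) differentiable (at s)"
    for k l using A by (cases "l = i") auto
  then have "(\<lambda>s. det (\<chi> k l. if l = i then (if k = j then 1 else 0) else A s $ k $ l)) differentiable (at s)"
    by (rule det_differentiable)
  then have "?f differentiable (at s)"
    using det_differentiable[OF A] nz by (rule differentiable_divide)
  then have "(?f has_vector_derivative vector_derivative ?f (at s)) (at s)"
    by (simp add: vector_derivative_works)
  \<comment> \<open>Cramer's formula holds where the determinant is nonzero, hence on a
    neighbourhood of s, which suffices for the derivative.\<close>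
  moreover have "\<forall>\<^sub>F s' in nhds s. matrix_inv (A s') $ i $ j = ?f s'"
    using eventually_det_nonzero[OF A nz] by eventually_elim (rule matrix_inv_cramer)
  ultimately have "((\<lambda>s. matrix_inv (A s) $ i $ j) has_vector_derivative vector_derivative ?f (at s)) (at s)"
    by (rule has_vector_derivative_cong_nhds[rotated])
  then show ?thesis by (rule differentiableI_vector)
qed

text \<open>Differentiating A^-1 A = 1 gives (A^-1)' A = -A^-1 A'. Since A' = e d has rank one, the
  derivative of the inverse splits into a column times a row, so derivatives of \<open>bil\<close>
  and \<open>tri\<close> are again expressed through such forms.\<close>

lemma has_vector_derivative_matrix_inv:
  fixes A :: "real \<Rightarrow> complex^'n^'n"
  assumes A: "\<And>i j. ((\<lambda>s. A s $ i $ j) has_vector_derivative e i * d j) (at s)" and nz: "det (A s) \<noteq> 0"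
  shows "((\<lambda>s. matrix_inv (A s) $ i $ j) has_vector_derivative
    - (\<Sum>k\<in>UNIV. matrix_inv (A s) $ i $ k * e k) * (\<Sum>k\<in>UNIV. d k * matrix_inv (A s) $ k $ j)) (at s)"
proof -
  let ?P = "matrix_inv (A s)"
  define D where "D i j = vector_derivative (\<lambda>s. matrix_inv (A s) $ i $ j) (at s)" for i j
  have Ad: "\<And>i j. (\<lambda>s. A s $ i $ j) differentiable (at s)" using A by (rule differentiableI_vector)
  have P: "((\<lambda>s. matrix_inv (A s) $ i $ j) has_vector_derivative D i j) (at s)" for i j
    using matrix_inv_differentiable[OF Ad nz] by (simp add: D_def vector_derivative_works)
  have AP: "(\<Sum>k\<in>UNIV. A s $ i $ k * ?P $ k $ j) = (if i = j then 1 else 0)" for i j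
    using matrix_inv_mult(1)[OF nz] by (simp add: matrix_matrix_mult_def mat_def vec_eq_iff)
  have eq: "(\<Sum>k\<in>UNIV. D i k * A s $ k $ j) = - (\<Sum>k\<in>UNIV. ?P $ i $ k * e k) * d j" for i j
  proof -
    have "((\<lambda>s. \<Sum>k\<in>UNIV. matrix_inv (A s) $ i $ k * A s $ k $ j) has_vector_derivative
        (\<Sum>k\<in>UNIV. ?P $ i $ k * (e k * d j) + D i k * A s $ k $ j)) (at s)"
      by (intro has_vector_derivative_sum has_vector_derivative_mult P A)
    moreover have "((\<lambda>s. \<Sum>k\<in>UNIV. matrix_inv (A s) $ i $ k * A s $ k $ j) has_vector_derivative 0) (at s)"
    proof (rule has_vector_derivative_cong_nhds)
      show "\<forall>\<^sub>F s' in nhds s. (\<Sum>k\<in>UNIV. matrix_inv (A s') $ i $ k * A s' $ k $ j) = (if i = j then 1 else 0)"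
        using eventually_det_nonzero[OF Ad nz]
      proof eventually_elim
        case (elim s')
        then show ?case
          using matrix_inv_mult(2)[OF elim] by (simp add: matrix_matrix_mult_def mat_def vec_eq_iff)
      qed
    qed (rule has_vector_derivative_const)
    ultimately have "(\<Sum>k\<in>UNIV. ?P $ i $ k * (e k * d j) + D i k * A s $ k $ j) = 0"
      by (rule vector_derivative_unique_at)
    then show ?thesis
      by (simp add: sum.distrib sum_distrib_right mult.assoc add_eq_0_iff2)
  qed
  \<comment> \<open>The factor A is removed from D A by multiplying with the inverse on the
    right.\<close>
  have "D i j = (\<Sum>k\<in>UNIV. D i k * (\<Sum>l\<in>UNIV. A s $ k $ l * ?P $ l $ j))"
    by (simp add: AP if_distrib cong: if_cong)
  also have "\<dots> = (\<Sum>k\<in>UNIV. \<Sum>l\<in>UNIV. D i k * A s $ k $ l * ?P $ l $ j)"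
    by (simp add: sum_distrib_left mult.assoc)
  also have "\<dots> = (\<Sum>l\<in>UNIV. \<Sum>k\<in>UNIV. D i k * A s $ k $ l * ?P $ l $ j)" by (rule sum.swap)
  also have "\<dots> = (\<Sum>l\<in>UNIV. - (\<Sum>k\<in>UNIV. ?P $ i $ k * e k) * d l * ?P $ l $ j)"
    by (simp only: sum_distrib_right[symmetric] eq)
  also have "\<dots> = - (\<Sum>k\<in>UNIV. ?P $ i $ k * e k) * (\<Sum>k\<in>UNIV. d k * ?P $ k $ j)"
    by (simp add: sum_distrib_left mult.assoc sum_negf)
  finally show ?thesis using P[of i j] by simp
qed

context
  fixes A :: "real \<Rightarrow> complex^'n^'n" and v x :: "real \<Rightarrow> 'n \<Rightarrow> complex" and v' x' e d s
  assumes A: "\<And>i j. ((\<lambda>s. A s $ i $ j) has_vector_derivative e i * d j) (at s)"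
    and nz: "det (A s) \<noteq> 0"
    and v: "\<And>i. ((\<lambda>s. v s i) has_vector_derivative v' i) (at s)"
    and x: "\<And>i. ((\<lambda>s. x s i) has_vector_derivative x' i) (at s)"
begin

lemma has_vector_derivative_inv_row:
  "((\<lambda>s. \<Sum>i\<in>UNIV. v s i * matrix_inv (A s) $ i $ k) has_vector_derivative
    (\<Sum>i\<in>UNIV. v' i * matrix_inv (A s) $ i $ k)
     - bil (matrix_inv (A s)) (v s) e * (\<Sum>i\<in>UNIV. d i * matrix_inv (A s) $ i $ k)) (at s)"
proof -
  let ?P = "matrix_inv (A s)"
  have "((\<lambda>s. \<Sum>i\<in>UNIV. v s i * matrix_inv (A s) $ i $ k) has_vector_derivative
    (\<Sum>i\<in>UNIV. v s i * (- (\<Sum>k\<in>UNIV. ?P $ i $ k * e k) * (\<Sum>i\<in>UNIV. d i * ?P $ i $ k)) + v' i * ?P $ i $ k)) (at s)"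
    by (intro has_vector_derivative_sum has_vector_derivative_mult v has_vector_derivative_matrix_inv A nz)
  then show ?thesis
    by (rule has_vector_derivative_eq_rhs)
      (simp add: sum.distrib sum_subtractf bil_def sum_negf sum_distrib_right mult.assoc)
qed

lemma has_vector_derivative_inv_col:
  "((\<lambda>s. \<Sum>j\<in>UNIV. matrix_inv (A s) $ k $ j * x s j) has_vector_derivative
    (\<Sum>j\<in>UNIV. matrix_inv (A s) $ k $ j * x' j)
     - (\<Sum>j\<in>UNIV. matrix_inv (A s) $ k $ j * e j) * bil (matrix_inv (A s)) d (x s)) (at s)"
proof -
  let ?P = "matrix_inv (A s)"
  have sum_rule: "(\<Sum>k\<in>UNIV. p k + (- \<alpha> * D k) * X k) = (\<Sum>k\<in>UNIV. p k) - \<alpha> * (\<Sum>k\<in>UNIV. D k * X k)"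
    for p D X :: "'n \<Rightarrow> complex" and \<alpha>
    by (simp add: sum.distrib sum_subtractf sum_negf sum_distrib_left mult.assoc)
  have "((\<lambda>s. \<Sum>j\<in>UNIV. matrix_inv (A s) $ k $ j * x s j) has_vector_derivative
    (\<Sum>j\<in>UNIV. ?P $ k $ j * x' j + (- (\<Sum>j\<in>UNIV. ?P $ k $ j * e j) * (\<Sum>i\<in>UNIV. d i * ?P $ i $ j)) * x s j)) (at s)"
    by (intro has_vector_derivative_sum has_vector_derivative_mult x has_vector_derivative_matrix_inv A nz)
  then show ?thesis
    by (rule has_vector_derivative_eq_rhs)
      (unfold bil_row, rule sum_rule[where D="\<lambda>k. \<Sum>i\<in>UNIV. d i * ?P $ i $ k"])
qed

lemma has_vector_derivative_bil:
  "((\<lambda>s. bil (matrix_inv (A s)) (v s) (x s)) has_vector_derivative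
    bil (matrix_inv (A s)) v' (x s) + bil (matrix_inv (A s)) (v s) x'
    - bil (matrix_inv (A s)) (v s) e * bil (matrix_inv (A s)) d (x s)) (at s)"
proof -
  let ?P = "matrix_inv (A s)"
  let ?C = "\<lambda>x k. \<Sum>j\<in>UNIV. ?P $ k $ j * x j"
  have "((\<lambda>s. bil (matrix_inv (A s)) (v s) (x s)) has_vector_derivative
    (\<Sum>k\<in>UNIV. v s k * (?C x' k - ?C e k * bil ?P d (x s)) + v' k * ?C (x s) k)) (at s)"
    unfolding bil_def[of "matrix_inv (A _)" "v _"]
    by (intro has_vector_derivative_sum has_vector_derivative_mult v has_vector_derivative_inv_col)
  then show ?thesis
    by (rule has_vector_derivative_eq_rhs)
      (simp only: bil_def[of _ v'] bil_def[of _ "v s"] sum.distrib sum_subtractf right_diff_distrib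
        sum_distrib_right mult.assoc, simp)
qed

lemma has_vector_derivative_tri:
  "((\<lambda>s. tri (matrix_inv (A s)) (v s) S (x s)) has_vector_derivative
    tri (matrix_inv (A s)) v' S (x s) + tri (matrix_inv (A s)) (v s) S x'
    - bil (matrix_inv (A s)) (v s) e * tri (matrix_inv (A s)) d S (x s)
    - tri (matrix_inv (A s)) (v s) S e * bil (matrix_inv (A s)) d (x s)) (at s)"
proof -
  let ?P = "matrix_inv (A s)"
  let ?R = "\<lambda>v k. \<Sum>i\<in>UNIV. v i * ?P $ i $ k" and ?C = "\<lambda>x k. \<Sum>j\<in>UNIV. ?P $ k $ j * x j"
  \<comment> \<open>The summand has the shape produced by the product rule; \<open>R k * 0\<close>
    comes from the constant weight \<open>S\<close>.\<close>
  have sum_rule: "(\<Sum>k\<in>UNIV. R k * S k * (X' k - E k * \<beta>) + (R k * 0 + (R' k - \<alpha> * D k) * S k) * X k)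
      = (\<Sum>k\<in>UNIV. R' k * S k * X k) + (\<Sum>k\<in>UNIV. R k * S k * X' k)
        - \<alpha> * (\<Sum>k\<in>UNIV. D k * S k * X k) - (\<Sum>k\<in>UNIV. R k * S k * E k) * \<beta>"
    for R R' D X X' E :: "'n \<Rightarrow> complex" and \<alpha> \<beta>
  proof -
    have "R k * S k * (X' k - E k * \<beta>) + (R k * 0 + (R' k - \<alpha> * D k) * S k) * X k
        = R' k * S k * X k + R k * S k * X' k - \<alpha> * (D k * S k * X k) - R k * S k * E k * \<beta>" for k
      by (simp add: algebra_simps)
    then show ?thesis
      by (simp add: sum.distrib sum_subtractf sum_distrib_left sum_distrib_right del: mult_zero_right)
  qed
  have "((\<lambda>s. tri (matrix_inv (A s)) (v s) S (x s)) has_vector_derivative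
    (\<Sum>k\<in>UNIV. ?R (v s) k * S k * (?C x' k - ?C e k * bil ?P d (x s))
       + (?R (v s) k * 0 + (?R v' k - bil ?P (v s) e * ?R d k) * S k) * ?C (x s) k)) (at s)"
    unfolding tri_def
    by (intro has_vector_derivative_sum has_vector_derivative_mult has_vector_derivative_inv_row
        has_vector_derivative_inv_col has_vector_derivative_const)
  then show ?thesis
    by (rule has_vector_derivative_eq_rhs)
      (unfold tri_def, rule sum_rule[where R="?R (v s)" and R'="?R v'" and D="?R d"
        and X="?C (x s)" and X'="?C x'" and E="?C e"])
qed

end

section \<open>The flow of the reduced matrix\<close>

lemma has_vector_derivative_exp_affine:
  fixes a c :: complex
  shows "((\<lambda>s. exp (a * of_real s + c)) has_vector_derivative a * exp (a * of_real s + c)) (at s)"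
proof -
  have "((\<lambda>s. a * of_real s + c) has_vector_derivative a) (at s)"
    by (auto intro!: derivative_eq_intros)
  from field_vector_diff_chain_at[OF this, of exp, OF DERIV_exp] show ?thesis by (simp add: o_def)
qed

text \<open>The field after removal of the unimodular phases. The rate \<open>\<gamma>\<close> is
  the coefficient that multiplies t / k_j in the reduced exponentials; it is free here and becomes
  tied to the amplitudes in \<open>Q_equation\<close>.\<close>

locale soliton_field =
  fixes \<kappa> S :: "'n::finite \<Rightarrow> complex" and \<gamma> :: real
  assumes not_real: "\<And>i. \<kappa> i \<notin> \<real>"
    and disjoint: "\<And>i j. \<kappa> i \<noteq> cnj (\<kappa> j)"
    and S_real: "\<And>i. cnj (S i) = S i"
begin

definition r :: "real \<Rightarrow> real \<Rightarrow> 'n \<Rightarrow> complex" where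
  "r x t j = exp (\<i> * (\<kappa> j * of_real x + of_real (\<gamma> * t) / \<kappa> j))"

definition c :: "real \<Rightarrow> real \<Rightarrow> 'n \<Rightarrow> complex" where "c x t j = cnj (r x t j)"

definition M :: "real \<Rightarrow> real \<Rightarrow> complex^'n^'n" where
  "M x t = (\<chi> i j. (cnj (\<kappa> i) * (c x t i * r x t j) + (if i = j then S i else 0)) / (\<kappa> j - cnj (\<kappa> i)))"

abbreviation P :: "real \<Rightarrow> real \<Rightarrow> complex^'n^'n" where "P x t \<equiv> matrix_inv (M x t)"

definition Q :: "complex \<Rightarrow> real \<Rightarrow> real \<Rightarrow> complex" where
  "Q b x t = 1 + b * bil (P x t) (\<lambda>i. r x t i / (\<kappa> i + b)) (c x t)"

definition Y :: "complex \<Rightarrow> real \<Rightarrow> real \<Rightarrow> complex" where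
  "Y b x t = tri (P x t) (\<lambda>i. r x t i / (\<kappa> i + b)) S (c x t)"

lemma kappa_nz: "\<kappa> i \<noteq> 0" "cnj (\<kappa> i) \<noteq> 0" "\<kappa> i + of_real b \<noteq> 0" "cnj (\<kappa> i) + of_real b \<noteq> 0"
proof -
  have im: "Im (\<kappa> i) \<noteq> 0" using not_real[of i] by (simp add: complex_is_Real_iff)
  then show "\<kappa> i \<noteq> 0" "cnj (\<kappa> i) \<noteq> 0" "\<kappa> i + of_real b \<noteq> 0" "cnj (\<kappa> i) + of_real b \<noteq> 0"
    by (auto simp: complex_eq_iff)
qed

lemma M_sylvester:
  "M x t $ i $ j * \<kappa> j = cnj (\<kappa> i) * M x t $ i $ j + cnj (\<kappa> i) * c x t i * r x t j + (if i = j then S i else 0)"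
proof -
  have "M x t $ i $ j * (\<kappa> j - cnj (\<kappa> i)) = cnj (\<kappa> i) * c x t i * r x t j + (if i = j then S i else 0)"
    unfolding M_def using disjoint[of j i] by (simp add: mult.assoc)
  then show ?thesis by (simp add: algebra_simps)
qed

lemma system:
  assumes "det (M x t) \<noteq> 0"
  shows "hermitian_cauchy_system \<kappa> (r x t) S (M x t) (P x t)"
  by unfold_locales
    (use matrix_inv_mult[OF assms] M_sylvester[of x t] disjoint S_real in \<open>auto simp: c_def\<close>)

lemma r_x: "((\<lambda>x. r x t j) has_vector_derivative \<i> * \<kappa> j * r x t j) (at x)"
proof -
  have "(\<lambda>x. r x t j) = (\<lambda>x. exp (\<i> * \<kappa> j * of_real x + \<i> * of_real (\<gamma> * t) / \<kappa> j))"
    by (simp add: r_def fun_eq_iff algebra_simps)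
  then show ?thesis
    using has_vector_derivative_exp_affine[of "\<i> * \<kappa> j" "\<i> * of_real (\<gamma> * t) / \<kappa> j" x] by metis
qed

lemma r_t: "((\<lambda>t. r x t j) has_vector_derivative \<i> * \<gamma> * (r x t j / \<kappa> j)) (at t)"
proof -
  have "(\<lambda>t. r x t j) = (\<lambda>t. exp (\<i> * of_real \<gamma> / \<kappa> j * of_real t + \<i> * \<kappa> j * of_real x))"
    by (simp add: r_def fun_eq_iff algebra_simps)
  then show ?thesis
    using has_vector_derivative_exp_affine[of "\<i> * of_real \<gamma> / \<kappa> j" "\<i> * \<kappa> j * of_real x" t]
    by (simp add: fun_eq_iff)
qed

lemma c_x: "((\<lambda>x. c x t j) has_vector_derivative - \<i> * (cnj (\<kappa> j) * c x t j)) (at x)"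
  using has_vector_derivative_cnj[OF r_x[of t j x]] by (simp add: c_def mult.assoc)

lemma c_t: "((\<lambda>t. c x t j) has_vector_derivative - \<i> * \<gamma> * (c x t j / cnj (\<kappa> j))) (at t)"
  using has_vector_derivative_cnj[OF r_t[of x j t]] by (simp add: c_def)

text \<open>The factor i (k_j - conj k_i) from differentiating the exponentials cancels the Cauchy
  denominator, which leaves rank one.\<close>

lemma M_x: "((\<lambda>x. M x t $ i $ j) has_vector_derivative (\<i> * (cnj (\<kappa> i) * c x t i)) * r x t j) (at x)"
proof -
  have "((\<lambda>x. (cnj (\<kappa> i) * (c x t i * r x t j) + (if i = j then S i else 0)) / (\<kappa> j - cnj (\<kappa> i)))
    has_vector_derivative
      (cnj (\<kappa> i) * (c x t i * (\<i> * \<kappa> j * r x t j) + (- \<i> * (cnj (\<kappa> i) * c x t i)) * r x t j) + 0)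
       / (\<kappa> j - cnj (\<kappa> i))) (at x)"
    by (intro has_vector_derivative_divide has_vector_derivative_add has_vector_derivative_const
        has_vector_derivative_mult_right has_vector_derivative_mult r_x c_x)
  then show ?thesis
    unfolding M_def using disjoint[of j i]
    by (simp add: mult.assoc) (auto elim!: has_vector_derivative_eq_rhs simp: field_simps)
qed

text \<open>Here 1 / k_j - 1 / conj k_i produces the factor -(k_j - conj k_i) / (k_j conj k_i),
  which cancels both the Cauchy denominator and the prefactor conj k_i.\<close>

lemma M_t: "((\<lambda>t. M x t $ i $ j) has_vector_derivative (- \<i> * \<gamma> * c x t i) * (r x t j / \<kappa> j)) (at t)"
proof -
  have "((\<lambda>t. (cnj (\<kappa> i) * (c x t i * r x t j) + (if i = j then S i else 0)) / (\<kappa> j - cnj (\<kappa> i)))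
    has_vector_derivative
      (cnj (\<kappa> i) * (c x t i * (\<i> * \<gamma> * (r x t j / \<kappa> j)) + (- \<i> * \<gamma> * (c x t i / cnj (\<kappa> i))) * r x t j) + 0)
       / (\<kappa> j - cnj (\<kappa> i))) (at t)"
    by (intro has_vector_derivative_divide has_vector_derivative_add has_vector_derivative_const
        has_vector_derivative_mult_right has_vector_derivative_mult r_t c_t)
  then show ?thesis
    unfolding M_def using disjoint[of j i] kappa_nz[of j] kappa_nz[of i]
    by (simp add: mult.assoc) (auto elim!: has_vector_derivative_eq_rhs simp: field_simps)
qed

section \<open>Derivatives and the reduced field equation at a regular point\<close>

context
  fixes x t :: real
  assumes nz: "det (M x t) \<noteq> 0"
begin

interpretation hermitian_cauchy_system \<kappa> "r x t" S "M x t" "P x t"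
  by (rule system[OF nz])

lemma cs_c: "cnj (r x t i) = c x t i" by (simp add: c_def)

lemma c_eta: "c x t = (\<lambda>i. cnj (r x t i))" by (simp add: c_def fun_eq_iff)

lemma Q_q: "Q b x t = q b" unfolding Q_def q_def c_eta ..
lemma Y_y: "Y b x t = y b" unfolding Y_def y_def c_eta ..

text \<open>The three terms of the product rule are those of \<open>bil_mult_kappa\<close>, so they
  collapse to the \<open>tri\<close> form.\<close>

lemma Q_x: "((\<lambda>x. Q (of_real b) x t) has_vector_derivative \<i> * b * Y b x t) (at x)"
proof -
  let ?v = "\<lambda>i. r x t i / (\<kappa> i + b)"
  have v: "((\<lambda>x. r x t i / (\<kappa> i + b)) has_vector_derivative \<i> * (?v i * \<kappa> i)) (at x)" for i
    using has_vector_derivative_divide[OF r_x, where a="\<kappa> i + b"] by (simp add: mult_ac)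
  have "((\<lambda>x. bil (P x t) (\<lambda>i. r x t i / (\<kappa> i + b)) (c x t)) has_vector_derivative
     bil (P x t) (\<lambda>i. \<i> * (?v i * \<kappa> i)) (c x t)
     + bil (P x t) ?v (\<lambda>i. - \<i> * (cnj (\<kappa> i) * c x t i))
     - bil (P x t) ?v (\<lambda>i. \<i> * (cnj (\<kappa> i) * c x t i)) * bil (P x t) (r x t) (c x t)) (at x)"
    by (rule has_vector_derivative_bil[OF M_x nz v c_x])
  then have "((\<lambda>x. bil (P x t) (\<lambda>i. r x t i / (\<kappa> i + b)) (c x t)) has_vector_derivative \<i> * Y b x t) (at x)"
    unfolding bil_scale_left bil_scale_right Y_y y_def
    using bil_mult_kappa[of ?v "c x t", unfolded cs_c]
    by (auto elim!: has_vector_derivative_eq_rhs simp: cs_c algebra_simps)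
  then have "((\<lambda>x. Q (of_real b) x t) has_vector_derivative 0 + of_real b * (\<i> * Y b x t)) (at x)"
    unfolding Q_def by (intro has_vector_derivative_add has_vector_derivative_const has_vector_derivative_mult_right)
  then show ?thesis by (simp add: mult_ac)
qed

text \<open>The t-derivative of \<open>Q\<close>, after the product rule has been collapsed by
  \<open>bil_div_kappa\<close> at 0.\<close>

definition Qt where
  "Qt b = - \<i> * \<gamma> * b * tri (P x t) (\<lambda>i. r x t i / (\<kappa> i + b)) (\<lambda>i. S i / (\<kappa> i * cnj (\<kappa> i))) (c x t)"

text \<open>The t-derivative of \<open>Y\<close>. Splitting b / (k (k + b)) as 1 / k - 1 / (k + b)
  yields the terms \<open>W 0\<close> and \<open>Y\<close>; the rank-one term of the product rule
  completes the coefficient of \<open>W 0\<close> to \<open>Q\<close>.\<close>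

definition Yt where
  "Yt b = \<i> * \<gamma> / b * (Q b x t * W 0 - Y b x t)
    - \<i> * \<gamma> * (tri (P x t) (\<lambda>i. r x t i / (\<kappa> i + b)) S (\<lambda>i. c x t i / cnj (\<kappa> i))
      - Y b x t * bil (P x t) (\<lambda>i. r x t i / \<kappa> i) (c x t))"

lemma Q_t: "((\<lambda>t. Q (of_real b) x t) has_vector_derivative Qt b) (at t)"
proof -
  let ?v = "\<lambda>i. r x t i / (\<kappa> i + b)"
  have v: "((\<lambda>t. r x t i / (\<kappa> i + b)) has_vector_derivative \<i> * \<gamma> * (?v i / \<kappa> i)) (at t)" for i
    using has_vector_derivative_divide[OF r_t, where a="\<kappa> i + b"] by (simp add: mult_ac)
  have "((\<lambda>t. bil (P x t) (\<lambda>i. r x t i / (\<kappa> i + b)) (c x t)) has_vector_derivative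
     bil (P x t) (\<lambda>i. \<i> * \<gamma> * (?v i / \<kappa> i)) (c x t)
     + bil (P x t) ?v (\<lambda>i. - \<i> * \<gamma> * (c x t i / cnj (\<kappa> i)))
     - bil (P x t) ?v (\<lambda>i. - \<i> * \<gamma> * c x t i) * bil (P x t) (\<lambda>i. r x t i / \<kappa> i) (c x t)) (at t)"
    by (rule has_vector_derivative_bil[OF M_t nz v c_t])
  moreover have "bil (P x t) ?v (\<lambda>i. c x t i / cnj (\<kappa> i)) = bil (P x t) (\<lambda>i. ?v i / \<kappa> i) (c x t)
      + bil (P x t) ?v (c x t) * bil (P x t) (\<lambda>i. r x t i / \<kappa> i) (c x t)
      + tri (P x t) ?v (\<lambda>i. S i / (\<kappa> i * cnj (\<kappa> i))) (c x t)"
    using bil_div_kappa[of 0 ?v "c x t", unfolded cs_c] kappa_nz by simp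
  ultimately have "((\<lambda>t. bil (P x t) (\<lambda>i. r x t i / (\<kappa> i + b)) (c x t)) has_vector_derivative
      - \<i> * \<gamma> * tri (P x t) ?v (\<lambda>i. S i / (\<kappa> i * cnj (\<kappa> i))) (c x t)) (at t)"
    unfolding bil_scale_left bil_scale_right
    by (auto elim!: has_vector_derivative_eq_rhs simp: algebra_simps)
  then have "((\<lambda>t. Q (of_real b) x t) has_vector_derivative 0 + of_real b *
      (- \<i> * \<gamma> * tri (P x t) ?v (\<lambda>i. S i / (\<kappa> i * cnj (\<kappa> i))) (c x t))) (at t)"
    unfolding Q_def by (intro has_vector_derivative_add has_vector_derivative_const has_vector_derivative_mult_right)
  then show ?thesis by (simp add: Qt_def mult_ac)
qed

lemma Y_t:
  assumes "b \<noteq> 0"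
  shows "((\<lambda>t. Y (of_real b) x t) has_vector_derivative Yt b) (at t)"
proof -
  let ?v = "\<lambda>i. r x t i / (\<kappa> i + b)"
  have v: "((\<lambda>t. r x t i / (\<kappa> i + b)) has_vector_derivative \<i> * \<gamma> * (?v i / \<kappa> i)) (at t)" for i
    using has_vector_derivative_divide[OF r_t, where a="\<kappa> i + b"] by (simp add: mult_ac)
  have W0: "W 0 = tri (P x t) (\<lambda>i. r x t i / \<kappa> i) S (c x t)"
    by (simp add: W_def c_eta kappa_nz)
  have "(\<lambda>i. \<i> * \<gamma> * (?v i / \<kappa> i)) = (\<lambda>i. \<i> * \<gamma> / b * (r x t i / \<kappa> i) + (- \<i> * \<gamma> / b) * ?v i)"
  proof
    fix i
    show "\<i> * \<gamma> * (?v i / \<kappa> i) = \<i> * \<gamma> / b * (r x t i / \<kappa> i) + (- \<i> * \<gamma> / b) * ?v i"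
      using assms kappa_nz(1)[of i] kappa_nz(3)[of i b] by (simp add: divide_simps) (simp add: algebra_simps)
  qed
  then have v': "((\<lambda>t. r x t i / (\<kappa> i + b)) has_vector_derivative
      \<i> * \<gamma> / b * (r x t i / \<kappa> i) + (- \<i> * \<gamma> / b) * ?v i) (at t)" for i
    using v by metis
  have tri_scale: "tri (P x t) v S (\<lambda>i. a * z i) = a * tri (P x t) v S z"
    "tri (P x t) (\<lambda>i. a * v i + a' * v' i) S z = a * tri (P x t) v S z + a' * tri (P x t) v' S z" for a a' v v' z
    by (simp_all only: tri_eq_bil_row bil_scale_right) (simp only: tri_eq_bil_row[symmetric] tri_eq_bil_col bil_add_left bil_scale_left)
  have "((\<lambda>t. tri (P x t) (\<lambda>i. r x t i / (\<kappa> i + b)) S (c x t)) has_vector_derivative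
     tri (P x t) (\<lambda>i. \<i> * \<gamma> / b * (r x t i / \<kappa> i) + (- \<i> * \<gamma> / b) * ?v i) S (c x t)
     + tri (P x t) ?v S (\<lambda>i. - \<i> * \<gamma> * (c x t i / cnj (\<kappa> i)))
     - bil (P x t) ?v (\<lambda>i. - \<i> * \<gamma> * c x t i) * tri (P x t) (\<lambda>i. r x t i / \<kappa> i) S (c x t)
     - tri (P x t) ?v S (\<lambda>i. - \<i> * \<gamma> * c x t i) * bil (P x t) (\<lambda>i. r x t i / \<kappa> i) (c x t)) (at t)"
    by (rule has_vector_derivative_tri[OF M_t nz v' c_t])
  then show ?thesis
    unfolding bil_scale_right tri_scale Yt_def W0 Y_def Q_def
    by (rule has_vector_derivative_eq_rhs) (use assms in \<open>simp add: field_simps\<close>)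
qed

text \<open>The linear part of the equation takes the form of the right-hand side of
  \<open>interaction\<close> with the pole \<open>\<beta>\<close> moved to 0, so both can be summed
  with the spectral weights.\<close>

lemma flow:
  assumes "b \<noteq> 0"
  shows "\<i> * b * Yt (of_real b) + \<i> * b * Qt b - \<gamma> * Y b x t
    = \<gamma> * (b * (1 - p b) * T 0 - Q b x t * W 0)"
proof -
  have f: "tri (P x t) (\<lambda>i. r x t i / (\<kappa> i + b)) S (\<lambda>i. c x t i / cnj (\<kappa> i))
      - Y b x t * bil (P x t) (\<lambda>i. r x t i / \<kappa> i) (c x t)
      + b * tri (P x t) (\<lambda>i. r x t i / (\<kappa> i + b)) (\<lambda>i. S i / (\<kappa> i * cnj (\<kappa> i))) (c x t) = (1 - p b) * T 0"
    unfolding Y_y c_eta by (rule flow_identity) (use kappa_nz in auto)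
  have "\<i> * b * Yt (of_real b) = - \<gamma> * (Q b x t * W 0 - Y b x t)
    + b * \<gamma> * (tri (P x t) (\<lambda>i. r x t i / (\<kappa> i + b)) S (\<lambda>i. c x t i / cnj (\<kappa> i))
      - Y b x t * bil (P x t) (\<lambda>i. r x t i / \<kappa> i) (c x t))"
    using assms unfolding Yt_def by (simp add: field_simps)
  moreover have "\<i> * b * Qt b = \<gamma> * b * (b * tri (P x t) (\<lambda>i. r x t i / (\<kappa> i + b)) (\<lambda>i. S i / (\<kappa> i * cnj (\<kappa> i))) (c x t))"
    unfolding Qt_def by (simp add: field_simps)
  ultimately show ?thesis using f unfolding of_real_mult of_real_minus by algebra
qed

lemma interaction:
  "(1 - Q \<beta> x t * cnj (Q \<beta> x t)) * ((of_real b + of_real \<beta>) * Q b x t + b * Y b x t)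
     - \<beta> * Q b x t * cnj (Q \<beta> x t) * Y \<beta> x t
    = \<beta> * (b * (1 - p b) * T \<beta> - Q b x t * W \<beta>)"
  unfolding Q_q Y_y cnj_q[OF complex_cnj_complex_of_real]
  by (rule component_identity) (use kappa_nz one_plus_g in auto)

text \<open>By \<open>flow\<close> and \<open>interaction\<close> the left side is the sum of b (1 -
  p) T(beta) - Q W(beta) over the poles 0, b1, b2 with weights 2 gamma, alpha1 b1, alpha2 b2. The
  weighted sums of T and of W vanish separately.\<close>

lemma Q_equation:
  fixes b b1 b2 \<alpha>1 \<alpha>2 :: real
  assumes b: "b \<noteq> 0" "b1 \<noteq> 0" "b2 \<noteq> 0" "b1 \<noteq> b2"
    and \<gamma>: "\<gamma> = 1 - (\<alpha>1 * b1 + \<alpha>2 * b2) / 2"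
    and spec: "\<And>i. 2 * \<gamma> / \<kappa> i + \<alpha>1 * b1 / (\<kappa> i + b1) + \<alpha>2 * b2 / (\<kappa> i + b2) = of_real (\<zeta> i)"
  shows "2 * (\<i> * b * Yt b + \<i> * b * Qt b - \<gamma> * Y b x t)
    + \<alpha>1 * ((1 - Q b1 x t * cnj (Q b1 x t)) * ((of_real b + of_real b1) * Q b x t + b * Y b x t)
            - b1 * Q b x t * cnj (Q b1 x t) * Y b1 x t)
    + \<alpha>2 * ((1 - Q b2 x t * cnj (Q b2 x t)) * ((of_real b + of_real b2) * Q b x t + b * Y b x t)
            - b2 * Q b x t * cnj (Q b2 x t) * Y b2 x t) = 0"
proof -
  define B :: "complex set" where "B = {0, of_real b1, of_real b2}"
  define w :: "complex \<Rightarrow> complex" where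
    \<comment> \<open>The weights are a function of the pole, so \<open>sumB\<close> rests on 0, b1,
      b2 being distinct.\<close>
    "w = (\<lambda>\<beta>. if \<beta> = 0 then 2 * \<gamma> else if \<beta> = of_real b1 then \<alpha>1 * b1 else \<alpha>2 * b2)"
  have sumB: "(\<Sum>\<beta>\<in>B. w \<beta> * f \<beta>) = 2 * \<gamma> * f 0 + \<alpha>1 * b1 * f b1 + \<alpha>2 * b2 * f b2" for f :: "complex \<Rightarrow> complex"
    using b by (simp add: B_def w_def)
  have fin: "finite B" by (simp add: B_def)
  have nzB: "\<kappa> i + \<beta> \<noteq> 0" "cnj (\<kappa> i) + \<beta> \<noteq> 0" if "\<beta> \<in> B" for i \<beta>
    using that kappa_nz by (auto simp: B_def)
  have spec1: "(\<Sum>\<beta>\<in>B. w \<beta> / (\<kappa> i + \<beta>)) = of_real (\<zeta> i)" for i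
    using spec[of i] sumB[of "\<lambda>\<beta>. 1 / (\<kappa> i + \<beta>)"] by simp
  \<comment> \<open>Weights, poles and the value \<open>\<zeta> i\<close> are real, so conjugation
    carries the spectral condition over to the conjugate point.\<close>
  have spec2: "(\<Sum>\<beta>\<in>B. w \<beta> / (cnj (\<kappa> i) + \<beta>)) = of_real (\<zeta> i)" for i
    using arg_cong[OF spec[of i], of cnj] sumB[of "\<lambda>\<beta>. 1 / (cnj (\<kappa> i) + \<beta>)"] by simp
  have T: "2 * \<gamma> * T 0 + \<alpha>1 * b1 * T b1 + \<alpha>2 * b2 * T b2 = 0"
    using weighted_T_sum[OF fin nzB disjoint spec1 spec2] sumB[of T] by simp
  have W: "2 * \<gamma> * W 0 + \<alpha>1 * b1 * W b1 + \<alpha>2 * b2 * W b2 = 0"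
    using weighted_W_sum[OF fin nzB disjoint spec1 spec2] sumB[of W] by simp
  show ?thesis
    unfolding flow[OF b(1)] interaction using T W unfolding of_real_mult of_real_numeral by algebra
qed

end

end

section \<open>Plane waves modulated by \<open>Q\<close> and the coupled equation for their
  amplitudes\<close>

context soliton_field
begin

lemma open_det_nonzero: "open {(x, t). det (M x t) \<noteq> 0}"
proof -
  have r: "continuous_on UNIV (\<lambda>s. r (fst s) (snd s) i)" for i
    unfolding r_def using kappa_nz by (intro continuous_intros) auto
  have "continuous_on UNIV (\<lambda>s. M (fst s) (snd s) $ i $ j)" for i j
    unfolding M_def c_def vec_lambda_beta
    by (rule continuous_on_divide, (intro continuous_intros r)+) (use disjoint[of j i] in auto)
  then have "open {s. det (M (fst s) (snd s)) \<noteq> 0}"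
    by (intro open_Collect_neq continuous_on_det continuous_on_const)
  then show ?thesis by (simp add: case_prod_unfold)
qed

context
  fixes a b k :: real and u :: "real \<Rightarrow> real \<Rightarrow> complex"
  assumes b: "b \<noteq> 0"
    and u: "\<And>x t. det (M x t) \<noteq> 0 \<Longrightarrow> u x t = a * Q b x t * exp (\<i> * of_real (b * x - k * t))"
begin

text \<open>The formula for \<open>u\<close> is assumed where the determinant is nonzero, which
  includes a neighbourhood of the point. The derivative i b \<open>Y\<close> of \<open>Q\<close> and
  the derivative of the carrier share the factor i b.\<close>

lemma plane_wave_x:
  assumes nz: "det (M x t) \<noteq> 0"
  shows "((\<lambda>y. u y t) has_vector_derivative
    \<i> * b * a * (Y b x t + Q b x t) * exp (\<i> * of_real (b * x - k * t))) (at x)"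
proof (rule has_vector_derivative_cong_nhds)
  show "\<forall>\<^sub>F y in nhds x. u y t = a * Q b y t * exp (\<i> * b * of_real y + - \<i> * k * t)"
    using eventually_det_nonzero[OF differentiableI_vector[OF M_x] nz]
    by eventually_elim (simp add: u algebra_simps)
  have "((\<lambda>y. a * Q b y t * exp (\<i> * b * of_real y + - \<i> * k * t)) has_vector_derivative
     (a * Q b x t * (\<i> * b * exp (\<i> * b * of_real x + - \<i> * k * t))
      + a * (\<i> * b * Y b x t) * exp (\<i> * b * of_real x + - \<i> * k * t))) (at x)"
    by (intro has_vector_derivative_mult has_vector_derivative_mult_right Q_x nz
        has_vector_derivative_exp_affine)
  then show "((\<lambda>y. a * Q b y t * exp (\<i> * b * of_real y + - \<i> * k * t)) has_vector_derivative
      \<i> * b * a * (Y b x t + Q b x t) * exp (\<i> * of_real (b * x - k * t))) (at x)"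
    by (rule has_vector_derivative_eq_rhs) (simp add: algebra_simps)
qed

lemma plane_wave_partial_x:
  assumes nz: "det (M x t) \<noteq> 0"
  shows "partial_x u x t = \<i> * b * a * (Y b x t + Q b x t) * exp (\<i> * of_real (b * x - k * t))"
  unfolding partial_x_def by (rule vector_derivative_at[OF plane_wave_x[OF nz]])

lemma plane_wave_xt:
  assumes nz: "det (M x t) \<noteq> 0"
  shows "((\<lambda>\<tau>. partial_x u x \<tau>) has_vector_derivative
    \<i> * b * a * (Yt x t b + Qt x t b - \<i> * k * (Y b x t + Q b x t)) * exp (\<i> * of_real (b * x - k * t))) (at t)"
proof (rule has_vector_derivative_cong_nhds)
  let ?E = "\<lambda>t. exp (- \<i> * k * of_real t + \<i> * b * x)"
  show "\<forall>\<^sub>F \<tau> in nhds t. partial_x u x \<tau> = \<i> * b * a * (Y b x \<tau> + Q b x \<tau>) * ?E \<tau>"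
    using eventually_det_nonzero[OF differentiableI_vector[OF M_t] nz]
    by eventually_elim (simp add: plane_wave_partial_x algebra_simps)
  have "((\<lambda>\<tau>. \<i> * b * a * (Y b x \<tau> + Q b x \<tau>) * ?E \<tau>) has_vector_derivative
     (\<i> * b * a * (Y b x t + Q b x t) * (- \<i> * k * ?E t)
      + \<i> * b * a * (Yt x t b + Qt x t b) * ?E t)) (at t)"
    by (intro has_vector_derivative_mult has_vector_derivative_mult_right has_vector_derivative_add
        Q_t Y_t b nz has_vector_derivative_exp_affine)
  then show "((\<lambda>\<tau>. \<i> * b * a * (Y b x \<tau> + Q b x \<tau>) * ?E \<tau>) has_vector_derivative
      \<i> * b * a * (Yt x t b + Qt x t b - \<i> * k * (Y b x t + Q b x t)) * exp (\<i> * of_real (b * x - k * t))) (at t)"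
    by (rule has_vector_derivative_eq_rhs) (simp add: algebra_simps)
qed

lemma plane_wave_partial_xt:
  assumes nz: "det (M x t) \<noteq> 0"
  shows "partial_t (partial_x u) x t
    = \<i> * b * a * (Yt x t b + Qt x t b - \<i> * k * (Y b x t + Q b x t)) * exp (\<i> * of_real (b * x - k * t))"
  unfolding partial_t_def by (rule vector_derivative_at[OF plane_wave_xt[OF nz]])

lemma plane_wave_has_derivs: "has_xt_derivs_on {(x, t). det (M x t) \<noteq> 0} u"
  unfolding has_xt_derivs_on_def
  using differentiableI_vector[OF plane_wave_x] differentiableI_vector[OF plane_wave_xt] by auto

end

text \<open>The field equation of either component, divided by its amplitude and carrier wave. The
  condition on \<open>k\<close> is the dispersion relation of the background; it turns
  \<open>Q_equation\<close>, written with 1 - |Q|^2, into the form with |Q|^2.\<close>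

lemma coupled_equation:
  fixes a b k a1 a2 b1 b2 k1 k2 \<alpha>1 \<alpha>2 x t :: real
  assumes nz: "det (M x t) \<noteq> 0"
    and b: "b \<noteq> 0" "b1 \<noteq> 0" "b2 \<noteq> 0" "b1 \<noteq> b2"
    and \<gamma>: "\<gamma> = 1 - (\<alpha>1 * b1 + \<alpha>2 * b2) / 2"
    and k: "k * b = (\<alpha>1 + \<alpha>2) * b / 2 - \<gamma>"
    and spec: "\<And>i. 2 * \<gamma> / \<kappa> i + \<alpha>1 * b1 / (\<kappa> i + b1) + \<alpha>2 * b2 / (\<kappa> i + b2) = of_real (\<zeta> i)"
  shows "\<i> * b * (Yt x t b + Qt x t b - \<i> * k * (Y b x t + Q b x t)) + Q b x t
    + \<i> / 2 * \<alpha>1 * (Q b1 x t * cnj (Q b1 x t) * (\<i> * b * (Y b x t + Q b x t))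
        + Q b x t * (cnj (Q b1 x t) * (\<i> * b1 * (Y b1 x t + Q b1 x t))))
    + \<i> / 2 * \<alpha>2 * (Q b2 x t * cnj (Q b2 x t) * (\<i> * b * (Y b x t + Q b x t))
        + Q b x t * (cnj (Q b2 x t) * (\<i> * b2 * (Y b2 x t + Q b2 x t)))) = 0"
    (is "?L = 0")
proof -
  let ?c = complex_of_real
  have k': "2 * (?c k * ?c b) = (?c \<alpha>1 + ?c \<alpha>2) * ?c b - 2 * ?c \<gamma>"
  proof -
    have "2 * (k * b) = (\<alpha>1 + \<alpha>2) * b - 2 * \<gamma>" using k by (simp add: field_simps)
    from arg_cong[OF this, of ?c] show ?thesis by simp
  qed
  have \<gamma>': "2 * ?c \<gamma> = 2 - ?c \<alpha>1 * ?c b1 - ?c \<alpha>2 * ?c b2"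
  proof -
    have "2 * \<gamma> = 2 - \<alpha>1 * b1 - \<alpha>2 * b2" using \<gamma> by (simp add: field_simps)
    from arg_cong[OF this, of ?c] show ?thesis by simp
  qed
  define q0 y0 where "q0 = Q b x t" and "y0 = Y b x t"
  define n1 n2 where "n1 = Q b1 x t * cnj (Q b1 x t)" and "n2 = Q b2 x t * cnj (Q b2 x t)"
  define c1 c2 where "c1 = cnj (Q b1 x t) * (b1 * (Y b1 x t + Q b1 x t))"
    and "c2 = cnj (Q b2 x t) * (b2 * (Y b2 x t + Q b2 x t))"
  define f where "f = Yt x t b + Qt x t b"
  have 1: "(1 - Q b1 x t * cnj (Q b1 x t)) * ((of_real b + of_real b1) * q0 + b * y0)
      - b1 * q0 * cnj (Q b1 x t) * Y b1 x t = (1 - n1) * (b * (y0 + q0)) + b1 * q0 - q0 * c1"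
    unfolding n1_def c1_def by (simp add: algebra_simps)
  have 2: "(1 - Q b2 x t * cnj (Q b2 x t)) * ((of_real b + of_real b2) * q0 + b * y0)
      - b2 * q0 * cnj (Q b2 x t) * Y b2 x t = (1 - n2) * (b * (y0 + q0)) + b2 * q0 - q0 * c2"
    unfolding n2_def c2_def by (simp add: algebra_simps)
  have eq: "2 * (\<i> * b * f - \<gamma> * y0)
    + \<alpha>1 * ((1 - n1) * (b * (y0 + q0)) + b1 * q0 - q0 * c1)
    + \<alpha>2 * ((1 - n2) * (b * (y0 + q0)) + b2 * q0 - q0 * c2) = 0"
    using Q_equation[OF nz b \<gamma> spec] unfolding q0_def[symmetric] y0_def[symmetric] 1 2
    by (simp add: f_def distrib_left)
  have i: "2 * (\<i> / 2 * \<alpha> * (n * (\<i> * b * s) + q * (cnj v * (\<i> * b' * w))))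
      = - \<alpha> * (n * (b * s) + q * (cnj v * (b' * w)))" for \<alpha> n b s q v b' w :: complex
    by (simp add: algebra_simps)
  have "2 * ?L = 2 * (\<i> * b * f) + 2 * (k * b) * (y0 + q0) + 2 * q0
      - \<alpha>1 * (n1 * (b * (y0 + q0)) + q0 * c1) - \<alpha>2 * (n2 * (b * (y0 + q0)) + q0 * c2)"
    unfolding distrib_left[of 2] i
    unfolding q0_def[symmetric] y0_def[symmetric] n1_def[symmetric] n2_def[symmetric]
      c1_def[symmetric] c2_def[symmetric] f_def[symmetric]
    by (simp add: right_diff_distrib mult_ac)
  \<comment> \<open>The first group is \<open>Q_equation\<close>. The two remainders are multiples
    of the dispersion relation and of the defining relation of gamma.\<close>
  also have "\<dots> = (2 * (\<i> * b * f - \<gamma> * y0)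
      + \<alpha>1 * ((1 - n1) * (b * (y0 + q0)) + b1 * q0 - q0 * c1)
      + \<alpha>2 * ((1 - n2) * (b * (y0 + q0)) + b2 * q0 - q0 * c2))
    + (2 * (?c k * ?c b) - ((?c \<alpha>1 + ?c \<alpha>2) * ?c b - 2 * ?c \<gamma>)) * (y0 + q0)
    + (2 - ?c \<alpha>1 * ?c b1 - ?c \<alpha>2 * ?c b2 - 2 * ?c \<gamma>) * q0"
    by (simp add: algebra_simps)
  also have "\<dots> = 0"
    unfolding eq k' \<gamma>' by simp
  finally have "2 * ?L = 0" .
  then show ?thesis by (metis mult_eq_0_iff zero_neq_numeral)
qed

end


section \<open>Soliton solutions\<close>

locale fokas_lenells_data =
  fixes \<sigma> a1 a2 b1 b2 :: real
    and z :: "'n::finite \<Rightarrow> real"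
    and \<kappa> :: "'n \<Rightarrow> complex"
    and \<epsilon> :: "'n \<Rightarrow> real"
  assumes b: "b1 \<noteq> 0" "b2 \<noteq> 0" "b1 \<noteq> b2"
    and inj_z: "inj z" and z_nz: "\<And>i. z i \<noteq> 0"
    and not_real: "\<And>i. \<kappa> i \<notin> \<real>"
    and spectral: "\<And>i. (inverse (of_real (z i)) * \<kappa> i - 2) * (\<kappa> i + of_real b1) * (\<kappa> i + of_real b2)
               + of_real (a1\<^sup>2 * b1\<^sup>2) * (\<kappa> i + of_real b2)
               + of_real (\<sigma> * a2\<^sup>2 * b2\<^sup>2) * (\<kappa> i + of_real b1) = 0"
begin

definition \<gamma> where "\<gamma> = 1 - (a1\<^sup>2 * b1 + \<sigma> * a2\<^sup>2 * b2) / 2"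

lemma kappa_nz: "\<kappa> i \<noteq> 0" "\<kappa> i + of_real b \<noteq> 0"
  using not_real[of i] by (auto simp: complex_is_Real_iff complex_eq_iff)

lemma two_gamma: "2 * complex_of_real \<gamma> = 2 - complex_of_real (a1\<^sup>2) * b1 - complex_of_real (\<sigma> * a2\<^sup>2) * b2"
proof -
  have "2 * \<gamma> = 2 - a1\<^sup>2 * b1 - \<sigma> * a2\<^sup>2 * b2" by (simp add: \<gamma>_def field_simps)
  from arg_cong[OF this, of complex_of_real] show ?thesis by simp
qed

text \<open>Divide the cubic condition by k (k + b1)(k + b2) and use b^2 / (k + b) = b - b k / (k +
  b); the constants collect to 2 gamma, the residue at 0.\<close>

lemma spectral_partial_fractions:
  "2 * \<gamma> / \<kappa> i + complex_of_real (a1\<^sup>2) * b1 / (\<kappa> i + b1) + complex_of_real (\<sigma> * a2\<^sup>2) * b2 / (\<kappa> i + b2) = of_real (1 / z i)"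
proof -
  define A1 A2 Z K1 K2 where "A1 = complex_of_real (a1\<^sup>2)" and "A2 = complex_of_real (\<sigma> * a2\<^sup>2)"
    and "Z = complex_of_real (1 / z i)" and "K1 = \<kappa> i + b1" and "K2 = \<kappa> i + b2"
  have g: "2 * complex_of_real \<gamma> = 2 - A1 * b1 - A2 * b2"
    unfolding A1_def A2_def by (rule two_gamma)
  have "(Z * \<kappa> i - 2) * K1 * K2 + A1 * (of_real b1)\<^sup>2 * K2 + A2 * (of_real b2)\<^sup>2 * K1 = 0"
    using spectral[of i] by (simp add: A1_def A2_def Z_def K1_def K2_def divide_inverse)
  then have "2 * complex_of_real \<gamma> * K1 * K2 + A1 * b1 * \<kappa> i * K2 + A2 * b2 * \<kappa> i * K1 = Z * \<kappa> i * K1 * K2"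
    using g K1_def K2_def by algebra
  then have "2 * \<gamma> / \<kappa> i + A1 * b1 / K1 + A2 * b2 / K2 = Z"
    using kappa_nz(1)[of i] kappa_nz(2)[of i b1] kappa_nz(2)[of i b2]
    unfolding K1_def[symmetric] K2_def[symmetric] by (simp add: divide_simps) (simp add: algebra_simps)
  then show ?thesis unfolding A1_def A2_def Z_def K1_def K2_def .
qed

text \<open>The real partial fraction takes the value 1 / z_i at k_i and 1 / z_j at the conjugate of
  k_j. Equality of the two points gives z_i = z_j, hence i = j, and then k_i would be real.\<close>

lemma disjoint: "\<kappa> i \<noteq> cnj (\<kappa> j)"
proof
  assume eq: "\<kappa> i = cnj (\<kappa> j)"
  have "complex_of_real (1 / z j) = of_real (1 / z i)"
    using arg_cong[OF spectral_partial_fractions[of j], of cnj] spectral_partial_fractions[of i] eq by simp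
  then have "z i = z j" by (simp only: of_real_eq_iff) simp
  then have "i = j" using inj_z by (simp add: inj_def)
  then show False using eq not_real[of i] by (simp add: complex_is_Real_iff complex_eq_iff)
qed

sublocale soliton_field \<kappa> "\<lambda>i. of_real (\<epsilon> i * cmod (\<kappa> i))" \<gamma>
  by unfold_locales (use not_real disjoint in auto)

definition phase :: "real \<Rightarrow> real \<Rightarrow> 'n \<Rightarrow> complex" where
  "phase x t j = exp (\<i> * of_real (- z j * x
     + (b1 + b2 - a1\<^sup>2 * b1\<^sup>2 - \<sigma> * a2\<^sup>2 * b2\<^sup>2 + z j - b1 * b2 / z j) / (2 * b1 * b2) * t))"

text \<open>Dividing the cubic condition by k_j shows that the coefficient of t in
  \<open>vartheta\<close>, up to the factor i, is a real number plus gamma / k_j. The real number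
  goes into \<open>phase\<close> and the rest into \<open>r\<close>.\<close>

lemma exp_vartheta: "exp (vartheta b1 b2 (z j) (\<kappa> j) x t) = phase x t j * r x t j"
proof -
  define A1 A2 Z B1 B2 zj where "A1 = complex_of_real (a1\<^sup>2)" and "A2 = complex_of_real (\<sigma> * a2\<^sup>2)"
    and "Z = complex_of_real (1 / z j)" and "B1 = complex_of_real b1" and "B2 = complex_of_real b2"
    and "zj = complex_of_real (z j)"
  have zZ: "zj * Z = 1" using z_nz by (simp add: zj_def Z_def)
  \<comment> \<open>Naming the inverses of k_j and z_j makes the required identity
    polynomial.\<close>
  define ki where "ki = 1 / \<kappa> j"
  have ki: "\<kappa> j * ki = 1" using kappa_nz by (simp add: ki_def)
  have g: "2 * complex_of_real \<gamma> = 2 - A1 * B1 - A2 * B2"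
    unfolding A1_def A2_def B1_def B2_def by (rule two_gamma)
  have "(Z * \<kappa> j - 2) * (\<kappa> j + B1) * (\<kappa> j + B2) + A1 * B1\<^sup>2 * (\<kappa> j + B2) + A2 * B2\<^sup>2 * (\<kappa> j + B1) = 0"
    using spectral[of j] by (simp add: A1_def A2_def Z_def B1_def B2_def divide_inverse)
  then have "Z * (\<kappa> j - zj) * (\<kappa> j - zj + B1 + B2)
      = B1 + B2 - A1 * B1\<^sup>2 - A2 * B2\<^sup>2 + zj - B1 * B2 * Z + 2 * B1 * B2 * (\<gamma> * ki)"
    using g ki zZ by algebra
  then have "Z * (\<kappa> j - zj) * (\<kappa> j - zj + B1 + B2) / (2 * B1 * B2)
      = (B1 + B2 - A1 * B1\<^sup>2 - A2 * B2\<^sup>2 + zj - B1 * B2 * Z) / (2 * B1 * B2) + \<gamma> * ki"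
    using b by (simp add: B1_def B2_def add_divide_distrib)
  moreover have "vartheta b1 b2 (z j) (\<kappa> j) x t = \<i> * ((\<kappa> j - zj) * x
      + (Z * (\<kappa> j - zj) * (\<kappa> j - zj + B1 + B2) / (2 * B1 * B2)) * t)"
  proof -
    define N1 N2 where "N1 = \<kappa> j - zj" and "N2 = \<kappa> j - zj + B1 + B2"
    have "1 / complex_of_real (2 * b1 * b2 * z j) = Z / (2 * B1 * B2)"
      by (simp add: Z_def B1_def B2_def)
    then have "vartheta b1 b2 (z j) (\<kappa> j) x t = \<i> * N1 * (x + Z / (2 * B1 * B2) * N2 * t)"
      by (simp only: vartheta_def N1_def N2_def zj_def B1_def B2_def)
    also have "\<dots> = \<i> * (N1 * x + (Z * N1 * N2 / (2 * B1 * B2)) * t)"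
      by (simp add: algebra_simps)
    finally show ?thesis unfolding N1_def N2_def .
  qed
  ultimately have "vartheta b1 b2 (z j) (\<kappa> j) x t = \<i> * ((\<kappa> j - zj) * x
      + ((B1 + B2 - A1 * B1\<^sup>2 - A2 * B2\<^sup>2 + zj - B1 * B2 * Z) / (2 * B1 * B2) + \<gamma> * ki) * t)"
    by simp
  also have "\<dots> = \<i> * of_real (- z j * x
     + (b1 + b2 - a1\<^sup>2 * b1\<^sup>2 - \<sigma> * a2\<^sup>2 * b2\<^sup>2 + z j - b1 * b2 / z j) / (2 * b1 * b2) * t)
     + \<i> * (\<kappa> j * of_real x + of_real (\<gamma> * t) / \<kappa> j)"
    by (simp add: zj_def B1_def B2_def Z_def A1_def A2_def ki_def algebra_simps)
  finally show ?thesis by (simp only: exp_add phase_def r_def)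
qed

lemma phase_unitary: "cnj (phase x t j) * phase x t j = 1"
  unfolding phase_def exp_cnj exp_add[symmetric] by simp

text \<open>The diagonal term takes up both phase factors freely, because on the diagonal their
  product is 1.\<close>

lemma phase_conj_entry:
  "1 / d * (f * (cnj (phase x t i) * y * phase x t j) + (if i = j then e else 0))
    = cnj (phase x t i) * ((f * y + (if i = j then e else 0)) / d) * phase x t j"
proof -
  have e: "(if i = j then e else 0) = cnj (phase x t i) * (if i = j then e else 0) * phase x t j"
    using phase_unitary[of x t j] by (auto simp: mult_ac)
  define e' where "e' = (if i = j then e else 0)"
  have "1 / d * (f * (cnj (phase x t i) * y * phase x t j) + cnj (phase x t i) * e' * phase x t j)
      = cnj (phase x t i) * ((f * y + e') / d) * phase x t j"
    by (simp add: distrib_left distrib_right add_divide_distrib mult_ac)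
  then show ?thesis unfolding e'_def e[symmetric] .
qed

lemma exp_vartheta_sum:
  "exp (vartheta b1 b2 (z j) (\<kappa> j) x t + cnj (vartheta b1 b2 (z i) (\<kappa> i) x t))
    = cnj (phase x t i) * (c x t i * r x t j) * phase x t j"
  by (simp add: exp_add exp_cnj[symmetric] exp_vartheta c_def)

lemma det_M_matrix: "det (M_matrix b1 b2 z \<kappa> \<epsilon> x t) = det (M x t)"
proof -
  have "M_matrix b1 b2 z \<kappa> \<epsilon> x t = (\<chi> i j. cnj (phase x t i) * M x t $ i $ j * phase x t j)"
  proof -
    have "M_matrix b1 b2 z \<kappa> \<epsilon> x t $ i $ j = cnj (phase x t i) * M x t $ i $ j * phase x t j" for i j
      unfolding M_matrix_def M_def vec_lambda_beta exp_vartheta_sum phase_conj_entry by (rule refl)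
    then show ?thesis by (simp add: vec_eq_iff)
  qed
  then show ?thesis by (simp only: det_unitary_diagonal_conj[OF phase_unitary])
qed

text \<open>From b (k_j - conj k_i) = (conj k_i + b) k_j - conj k_i (k_j + b), the Cauchy
  denominator cancels in the difference of the reduced matrices of H and M, which is the rank-one
  matrix with entries c_i b r_j / (k_j + b).\<close>

lemma det_H_matrix:
  assumes "det (M x t) \<noteq> 0"
  shows "det (H_matrix b b1 b2 z \<kappa> \<epsilon> x t) = det (M x t) * Q b x t"
proof -
  let ?v = "\<lambda>j. of_real b * (r x t j / (\<kappa> j + of_real b))"
  let ?A = "(\<chi> i j. M x t $ i $ j + c x t i * ?v j) :: complex^'n^'n"
  have "H_matrix b b1 b2 z \<kappa> \<epsilon> x t = (\<chi> i j. cnj (phase x t i) * ?A $ i $ j * phase x t j)"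
  proof -
    have "H_matrix b b1 b2 z \<kappa> \<epsilon> x t $ i $ j = cnj (phase x t i) * ?A $ i $ j * phase x t j" for i j
    proof -
      define e X where "e = (if i = j then complex_of_real (\<epsilon> i * cmod (\<kappa> i)) else 0)" and "X = c x t i * r x t j"
      have nz: "\<kappa> j + b \<noteq> 0" "\<kappa> j - cnj (\<kappa> i) \<noteq> 0"
        using disjoint[of j i] kappa_nz(3)[of j b] by auto
      have "b * (\<kappa> j - cnj (\<kappa> i)) = (cnj (\<kappa> i) + b) * \<kappa> j - cnj (\<kappa> i) * (\<kappa> j + b)"
        by (simp add: algebra_simps)
      then have "b / (\<kappa> j + b) = ((cnj (\<kappa> i) + b) / (\<kappa> j + b) * \<kappa> j - cnj (\<kappa> i)) / (\<kappa> j - cnj (\<kappa> i))"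
        using nz by (simp add: divide_simps mult_ac)
      then have "(cnj (\<kappa> i) * X + e) / (\<kappa> j - cnj (\<kappa> i)) + X * (b / (\<kappa> j + b))
          = (cnj (\<kappa> i) * X + e + X * ((cnj (\<kappa> i) + b) / (\<kappa> j + b) * \<kappa> j - cnj (\<kappa> i))) / (\<kappa> j - cnj (\<kappa> i))"
        by (metis add_divide_distrib times_divide_eq_right)
      also have "cnj (\<kappa> i) * X + e + X * ((cnj (\<kappa> i) + b) / (\<kappa> j + b) * \<kappa> j - cnj (\<kappa> i))
          = (cnj (\<kappa> i) + b) / (\<kappa> j + b) * \<kappa> j * X + e"
        by (simp only: right_diff_distrib mult_ac) simp
      finally have A: "?A $ i $ j = ((cnj (\<kappa> i) + b) / (\<kappa> j + b) * \<kappa> j * (c x t i * r x t j)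
          + (if i = j then of_real (\<epsilon> i * cmod (\<kappa> i)) else 0)) / (\<kappa> j - cnj (\<kappa> i))"
        unfolding M_def vec_lambda_beta by (simp add: X_def e_def mult_ac)
      show ?thesis
        unfolding A
        unfolding H_matrix_def vec_lambda_beta exp_vartheta_sum phase_conj_entry by (rule refl)
    qed
    then show ?thesis by (simp add: vec_eq_iff)
  qed
  then show ?thesis
    by (simp only: det_unitary_diagonal_conj[OF phase_unitary] det_rank_one_update[OF assms]
        bil_scale_left Q_def)
qed

end

theorem mainTheorem7:
  fixes \<sigma> a1 a2 b1 b2 :: real
    and z :: "'n::finite \<Rightarrow> real"
    and \<kappa> :: "'n \<Rightarrow> complex"
    and \<epsilon> :: "'n \<Rightarrow> real"
  assumes "\<sigma> = 1 \<or> \<sigma> = -1"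
    and "a1 \<noteq> 0" and "a2 \<noteq> 0" and "b1 \<noteq> 0" and "b2 \<noteq> 0" and "b1 \<noteq> b2"
    and "inj z" and "\<And>i. z i \<noteq> 0"
    and "\<And>i. \<kappa> i \<notin> \<real>"
    and "\<And>i. (inverse (of_real (z i)) * \<kappa> i - 2) * (\<kappa> i + of_real b1) * (\<kappa> i + of_real b2)
               + of_real (a1\<^sup>2 * b1\<^sup>2) * (\<kappa> i + of_real b2)
               + of_real (\<sigma> * a2\<^sup>2 * b2\<^sup>2) * (\<kappa> i + of_real b1) = 0"
    and "\<And>i. \<epsilon> i = 1 \<or> \<epsilon> i = -1"
  shows "coupled_FL_solution_on \<sigma> {(x, t). det (M_matrix b1 b2 z \<kappa> \<epsilon> x t) \<noteq> 0}
           (soliton_u1 \<sigma> a1 a2 b1 b2 z \<kappa> \<epsilon>) (soliton_u2 \<sigma> a1 a2 b1 b2 z \<kappa> \<epsilon>)"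
proof -
  interpret fokas_lenells_data \<sigma> a1 a2 b1 b2 z \<kappa> \<epsilon>
    using assms by unfold_locales
  let ?u1 = "soliton_u1 \<sigma> a1 a2 b1 b2 z \<kappa> \<epsilon>" and ?u2 = "soliton_u2 \<sigma> a1 a2 b1 b2 z \<kappa> \<epsilon>"
  \<comment> \<open>The sign sigma is absorbed into \<open>\<alpha>2\<close>, so one amplitude
    equation serves both components; \<open>k1\<close> and \<open>k2\<close> are the frequencies of
    omega_1 and omega_2.\<close>
  define \<alpha>1 \<alpha>2 where "\<alpha>1 = a1\<^sup>2" and "\<alpha>2 = \<sigma> * a2\<^sup>2"
  define k1 k2 where "k1 = (\<alpha>1 + \<alpha>2) / 2 - \<gamma> / b1" and "k2 = (\<alpha>1 + \<alpha>2) / 2 - \<gamma> / b2"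
  have kb: "k1 * b1 = (\<alpha>1 + \<alpha>2) * b1 / 2 - \<gamma>" "k2 * b2 = (\<alpha>1 + \<alpha>2) * b2 / 2 - \<gamma>"
    using b by (simp_all add: k1_def k2_def field_simps)
  have \<gamma>: "\<gamma> = 1 - (\<alpha>1 * b1 + \<alpha>2 * b2) / 2"
    by (simp add: \<gamma>_def \<alpha>1_def \<alpha>2_def)
  have o1: "omega1 \<sigma> a1 a2 b1 b2 x t = b1 * x - k1 * t" for x t
    using b by (simp add: omega1_def k1_def \<gamma> \<alpha>1_def \<alpha>2_def divide_simps) (simp add: algebra_simps)
  have o2: "omega2 \<sigma> a1 a2 b1 b2 x t = b2 * x - k2 * t" for x t
    using b by (simp add: omega2_def k2_def \<gamma> \<alpha>1_def \<alpha>2_def divide_simps) (simp add: algebra_simps)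
  have u1: "?u1 x t = a1 * Q b1 x t * exp (\<i> * of_real (b1 * x - k1 * t))" if "det (M x t) \<noteq> 0" for x t
    unfolding soliton_u1_def det_M_matrix det_H_matrix[OF that] o1 using that by simp
  have u2: "?u2 x t = a2 * Q b2 x t * exp (\<i> * of_real (b2 * x - k2 * t))" if "det (M x t) \<noteq> 0" for x t
    unfolding soliton_u2_def det_M_matrix det_H_matrix[OF that] o2 using that by simp
  have spec: "2 * \<gamma> / \<kappa> i + \<alpha>1 * b1 / (\<kappa> i + b1) + \<alpha>2 * b2 / (\<kappa> i + b2) = of_real (1 / z i)" for i
    using spectral_partial_fractions[of i] by (simp add: \<alpha>1_def \<alpha>2_def)
  have "partial_t (partial_x ?u1) x t + ?u1 x t
          + \<i> * of_real ((cmod (?u1 x t))\<^sup>2 + 1/2 * \<sigma> * (cmod (?u2 x t))\<^sup>2) * partial_x ?u1 x t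
          + \<i> / 2 * of_real \<sigma> * ?u1 x t * cnj (?u2 x t) * partial_x ?u2 x t = 0"
    and "partial_t (partial_x ?u2) x t + ?u2 x t
          + \<i> * of_real (\<sigma> * (cmod (?u2 x t))\<^sup>2 + 1/2 * (cmod (?u1 x t))\<^sup>2) * partial_x ?u2 x t
          + \<i> / 2 * ?u2 x t * cnj (?u1 x t) * partial_x ?u1 x t = 0"
    if nz: "det (M x t) \<noteq> 0" for x t
  proof -
    define E1 E2 where "E1 = exp (\<i> * of_real (b1 * x - k1 * t))" and "E2 = exp (\<i> * of_real (b2 * x - k2 * t))"
    have E: "E1 * cnj E1 = 1" "E2 * cnj E2 = 1"
      unfolding E1_def E2_def exp_cnj exp_add[symmetric] by simp_all
    define q1 q2 y1 y2 where "q1 = Q b1 x t" and "q2 = Q b2 x t" and "y1 = Y b1 x t" and "y2 = Y b2 x t"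
    note defs = E1_def q1_def y1_def E2_def q2_def y2_def
    have u1': "?u1 x t = a1 * q1 * E1" and u2': "?u2 x t = a2 * q2 * E2"
      unfolding defs by (rule u1[OF nz], rule u2[OF nz])
    have d1: "partial_x ?u1 x t = \<i> * b1 * a1 * (y1 + q1) * E1"
      unfolding defs by (rule plane_wave_partial_x[OF b(1) u1 nz])
    have e1: "partial_t (partial_x ?u1) x t
        = \<i> * b1 * a1 * (Yt x t b1 + Qt x t b1 - \<i> * k1 * (y1 + q1)) * E1"
      unfolding defs by (rule plane_wave_partial_xt[OF b(1) u1 nz])
    have d2: "partial_x ?u2 x t = \<i> * b2 * a2 * (y2 + q2) * E2"
      unfolding defs by (rule plane_wave_partial_x[OF b(2) u2 nz])
    have e2: "partial_t (partial_x ?u2) x t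
        = \<i> * b2 * a2 * (Yt x t b2 + Qt x t b2 - \<i> * k2 * (y2 + q2)) * E2"
      unfolding defs by (rule plane_wave_partial_xt[OF b(2) u2 nz])
    have n1: "complex_of_real ((cmod (?u1 x t))\<^sup>2) = \<alpha>1 * (q1 * cnj q1)"
      unfolding complex_norm_square u1' \<alpha>1_def
      unfolding of_real_mult of_real_power complex_cnj_mult complex_cnj_complex_of_real
      using E(1) by algebra
    have n2: "\<sigma> * complex_of_real ((cmod (?u2 x t))\<^sup>2) = \<alpha>2 * (q2 * cnj q2)"
      unfolding complex_norm_square u2' \<alpha>2_def
      unfolding of_real_mult of_real_power complex_cnj_mult complex_cnj_complex_of_real
      using E(2) by algebra
    have c1: "cnj (?u1 x t) * partial_x ?u1 x t = \<alpha>1 * (cnj q1 * (\<i> * b1 * (y1 + q1)))"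
      unfolding d1 u1' \<alpha>1_def of_real_mult of_real_power complex_cnj_mult complex_cnj_complex_of_real
      using E(1) by algebra
    have c2: "\<sigma> * (cnj (?u2 x t) * partial_x ?u2 x t) = \<alpha>2 * (cnj q2 * (\<i> * b2 * (y2 + q2)))"
      unfolding d2 u2' \<alpha>2_def of_real_mult of_real_power complex_cnj_mult complex_cnj_complex_of_real
      using E(2) by algebra
    note eq = coupled_equation[OF nz _ b \<gamma> _ spec, unfolded q1_def[symmetric] q2_def[symmetric]
        y1_def[symmetric] y2_def[symmetric]]
    show "partial_t (partial_x ?u1) x t + ?u1 x t
          + \<i> * of_real ((cmod (?u1 x t))\<^sup>2 + 1/2 * \<sigma> * (cmod (?u2 x t))\<^sup>2) * partial_x ?u1 x t
          + \<i> / 2 * of_real \<sigma> * ?u1 x t * cnj (?u2 x t) * partial_x ?u2 x t = 0" (is "?L = 0")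
    proof -
      have "?L = partial_t (partial_x ?u1) x t + ?u1 x t
          + \<i> * (complex_of_real ((cmod (?u1 x t))\<^sup>2) + 1/2 * (\<sigma> * complex_of_real ((cmod (?u2 x t))\<^sup>2))) * partial_x ?u1 x t
          + \<i> / 2 * ?u1 x t * (\<sigma> * (cnj (?u2 x t) * partial_x ?u2 x t))"
        by simp
      \<comment> \<open>The self-interaction i |u1|^2 u1_x is split into two equal halves, to match
        the symmetric form of \<open>coupled_equation\<close> at b = b1.\<close>
      also have "\<dots> = a1 * E1 * (\<i> * b1 * (Yt x t b1 + Qt x t b1 - \<i> * k1 * (y1 + q1)) + q1
    + \<i> / 2 * \<alpha>1 * (q1 * cnj q1 * (\<i> * b1 * (y1 + q1)) + q1 * (cnj q1 * (\<i> * b1 * (y1 + q1))))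
    + \<i> / 2 * \<alpha>2 * (q2 * cnj q2 * (\<i> * b1 * (y1 + q1)) + q1 * (cnj q2 * (\<i> * b2 * (y2 + q2)))))"
        unfolding n1 n2 c2
        unfolding e1 d1 u1' by (simp add: algebra_simps)
      also have "\<dots> = 0"
        using eq[OF b(1) kb(1)] by (simp only: q1_def[symmetric] y1_def[symmetric] mult_zero_right)
      finally show ?thesis .
    qed
    show "partial_t (partial_x ?u2) x t + ?u2 x t
          + \<i> * of_real (\<sigma> * (cmod (?u2 x t))\<^sup>2 + 1/2 * (cmod (?u1 x t))\<^sup>2) * partial_x ?u2 x t
          + \<i> / 2 * ?u2 x t * cnj (?u1 x t) * partial_x ?u1 x t = 0" (is "?L = 0")
    proof -
      have "?L = partial_t (partial_x ?u2) x t + ?u2 x t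
          + \<i> * (\<sigma> * complex_of_real ((cmod (?u2 x t))\<^sup>2) + 1/2 * complex_of_real ((cmod (?u1 x t))\<^sup>2)) * partial_x ?u2 x t
          + \<i> / 2 * ?u2 x t * (cnj (?u1 x t) * partial_x ?u1 x t)"
        by simp
      \<comment> \<open>The same splitting, now of the sigma |u2|^2 term, gives the instance b =
        b2.\<close>
      also have "\<dots> = a2 * E2 * (\<i> * b2 * (Yt x t b2 + Qt x t b2 - \<i> * k2 * (y2 + q2)) + q2
    + \<i> / 2 * \<alpha>1 * (q1 * cnj q1 * (\<i> * b2 * (y2 + q2)) + q2 * (cnj q1 * (\<i> * b1 * (y1 + q1))))
    + \<i> / 2 * \<alpha>2 * (q2 * cnj q2 * (\<i> * b2 * (y2 + q2)) + q2 * (cnj q2 * (\<i> * b2 * (y2 + q2)))))"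
        unfolding n1 n2 c1
        unfolding e2 d2 u2' by (simp add: algebra_simps)
      also have "\<dots> = 0"
        using eq[OF b(2) kb(2)] by (simp only: q2_def[symmetric] y2_def[symmetric] mult_zero_right)
      finally show ?thesis .
    qed
  qed
  moreover have "has_xt_derivs_on {(x, t). det (M x t) \<noteq> 0} ?u1"
    by (rule plane_wave_has_derivs[OF b(1) u1])
  moreover have "has_xt_derivs_on {(x, t). det (M x t) \<noteq> 0} ?u2"
    by (rule plane_wave_has_derivs[OF b(2) u2])
  ultimately show ?thesis
    unfolding coupled_FL_solution_on_def det_M_matrix using open_det_nonzero by auto
qed

end
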